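(* Let $r\ge1$ and let $\mathbf{n}=(n_1,\dots,n_r)\in\mathbb{Z}^r$ be a regular integer point of $\zeta_r$. Let $d$ be the number of indices $i$ with $n_i>0$ and $w$ the sum of those positive $n_i$. Then $\zeta_r(n_1,\dots,n_r)\in Z^{\le d}_{\le w}$; in particular $\zeta_r(n_1,\dots,n_r)$ is an explicit rational linear combination of multiple zeta values.
   Context: For a positive integer $r$, $\zeta_r(s_1,\dots,s_r)=\sum_{0<m_1<\cdots<m_r} m_1^{-s_1}\cdots m_r^{-s_r}$ is the Euler–Zagier multiple zeta function, meromorphically continued to $\mathbb{C}^r$. Its singular set is the union of the hyperplanes $s_r=1$; $s_{r-1}+s_r=c$ for $c\in\{2,1,0,-2,-4,\dots\}$ (when $r\ge2$); and $\sum_{i=1}^{k}s_{r-i+1}=c$ for $c\in\mathbb{Z}_{\le k}$, $k=3,\dots,r$. A regular integer point is a point of $\mathbb{Z}^r$ not in this set. A multiple zeta value is $\zeta_n(m_1,\dots,m_n)$ with $m_i$ positive integers and $m_n\ge2$ (an admissible index), of weight $m_1+\cdots+m_n$; by convention $\zeta(\emptyset)=1$. For $a,b\in\mathbb{N}_0$, $Z^{\le a}_{\le b}$ is the $\mathbb{Q}$-linear span of $\zeta_n(\mathbf{m})$ over admissible indices $\mathbf{m}$ of depth $n\in\{0,1,\dots,a\}$ and weight $\le b$ (including $\zeta(\emptyset)=1$). *)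

theory Defs
  imports "HOL-Complex_Analysis.Complex_Analysis"
begin

text \<open>
  A point \<open>(s\<^sub>1, \<dots>, s\<^sub>r)\<close> of \<open>\<complex>\<^sup>r\<close> is an extensional function on \<open>{1..r}\<close>. The product topology
  on \<^typ>\<open>nat \<Rightarrow> complex\<close> restricts to the usual topology of \<open>\<complex>\<^sup>r\<close>.
\<close>

definition complex_space :: "nat \<Rightarrow> (nat \<Rightarrow> complex) set" where
  "complex_space r = {1..r} \<rightarrow>\<^sub>E UNIV"

definition int_point :: "nat \<Rightarrow> (nat \<Rightarrow> int) \<Rightarrow> nat \<Rightarrow> complex" where
  "int_point r n = (\<lambda>i\<in>{1..r}. of_int (n i))"

definition increasing_tuples :: "nat \<Rightarrow> (nat \<Rightarrow> nat) set" where
  "increasing_tuples r = {m \<in> {1..r} \<rightarrow>\<^sub>E {0<..}. strict_mono_on {1..r} m}"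

definition mzeta_series :: "nat \<Rightarrow> (nat \<Rightarrow> complex) \<Rightarrow> complex" where
  "mzeta_series r s = (\<Sum>\<^sub>\<infinity>m\<in>increasing_tuples r. \<Prod>i=1..r. of_nat (m i) powr (- s i))"

definition last_sum :: "nat \<Rightarrow> nat \<Rightarrow> (nat \<Rightarrow> 'a::comm_monoid_add) \<Rightarrow> 'a" where
  "last_sum r k s = (\<Sum>i=1..k. s (r - i + 1))"

text \<open>The region of absolute convergence of \<^const>\<open>mzeta_series\<close>.\<close>

definition convergence_region :: "nat \<Rightarrow> (nat \<Rightarrow> complex) set" where
  "convergence_region r = {s \<in> complex_space r. \<forall>k\<in>{1..r}. Re (last_sum r k s) > real k}"

text \<open>The singular hyperplanes are \<open>s\<^sub>r + \<dots> + s\<^bsub>r-k+1\<^esub> = c\<close> with \<open>1 \<le> k \<le> r\<close> and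
  \<open>c \<in> singular_values k\<close>.\<close>

definition singular_values :: "nat \<Rightarrow> int set" where
  "singular_values k =
     (if k = 1 then {1} else if k = 2 then {2, 1} \<union> range (\<lambda>j::nat. - 2 * int j) else {..int k})"

definition regular_points :: "nat \<Rightarrow> (nat \<Rightarrow> complex) set" where
  "regular_points r =
     {s \<in> complex_space r. \<forall>k\<in>{1..r}. last_sum r k s \<notin> of_int ` singular_values k}"

text \<open>Holomorphy on an open subset of \<open>\<complex>\<^sup>r\<close>: continuous, and holomorphic in each variable
  separately (equivalent to complex differentiability by Osgood's lemma).\<close>

definition holomorphic_several :: "nat \<Rightarrow> ((nat \<Rightarrow> complex) \<Rightarrow> complex) \<Rightarrow> (nat \<Rightarrow> complex) set \<Rightarrow> bool" where
  "holomorphic_several r F U \<longleftrightarrow> continuous_on U F \<and>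
     (\<forall>s\<in>U. \<forall>i\<in>{1..r}. (\<lambda>z. F (s(i := z))) holomorphic_on {z. s(i := z) \<in> U})"

definition mzeta_continuation :: "nat \<Rightarrow> ((nat \<Rightarrow> complex) \<Rightarrow> complex) \<Rightarrow> bool" where
  "mzeta_continuation r F \<longleftrightarrow> holomorphic_several r F (regular_points r) \<and>
     (\<forall>s\<in>convergence_region r. F s = mzeta_series r s)"

text \<open>By \<open>mzeta_continuation_unique\<close> below, the choice of the continuation does not affect
  the values at regular points; elsewhere the values are meaningless.\<close>

definition mzeta :: "nat \<Rightarrow> (nat \<Rightarrow> complex) \<Rightarrow> complex" where
  "mzeta r = (SOME F. mzeta_continuation r F)"

definition admissible :: "nat \<Rightarrow> (nat \<Rightarrow> int) \<Rightarrow> bool" where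
  "admissible n m \<longleftrightarrow> (\<forall>i\<in>{1..n}. m i \<ge> 1) \<and> (n \<ge> 1 \<longrightarrow> m n \<ge> 2)"

definition mzv :: "nat \<Rightarrow> (nat \<Rightarrow> int) \<Rightarrow> complex" where
  "mzv n m = (if n = 0 then 1 else mzeta n (int_point n m))"

definition rat_span :: "complex set \<Rightarrow> complex set" where
  "rat_span = module.span (\<lambda>(q::rat) z. of_rat q * z)"

lemma vector_space_rat_complex: "vector_space (\<lambda>(q::rat) (z::complex). of_rat q * z)"
  by unfold_locales (simp_all add: algebra_simps of_rat_add of_rat_mult)

definition mzv_space :: "nat \<Rightarrow> nat \<Rightarrow> complex set" where
  "mzv_space a b =
     rat_span {mzv n m | n m. n \<le> a \<and> admissible n m \<and> (\<Sum>i=1..n. m i) \<le> int b}"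

lemma last_sum_upd:
  fixes s :: "nat \<Rightarrow> complex"
  assumes "k \<in> {1..r}"
  shows "last_sum r k (s(r := z)) = z + last_sum r k (s(r := 0))"
proof -
  have "(\<Sum>i=2..k. (s(r := z)) (r - i + 1)) = (\<Sum>i=2..k. (s(r := 0)) (r - i + 1))"
    using assms by (intro sum.cong) auto
  moreover have "last_sum r k f = f r + (\<Sum>i=2..k. f (r - i + 1))" for f :: "nat \<Rightarrow> complex"
    using assms by (simp add: last_sum_def sum.atLeast_Suc_atMost numeral_2_eq_2)
  ultimately show ?thesis by simp
qed

lemma mzeta_continuation_unique:
  assumes r: "r \<ge> 1" and F: "mzeta_continuation r F" and G: "mzeta_continuation r G"
    and s: "s \<in> regular_points r"
  shows "F s = G s"
proof -
  define a where "a k = last_sum r k (s(r := 0))" for k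
  define D where "D = {z. s(r := z) \<in> regular_points r}"
  define E where "E = {z. s(r := z) \<in> convergence_region r}"
  have sp: "s(r := z) \<in> complex_space r" for z
    using s r by (auto simp: regular_points_def complex_space_def PiE_def extensional_def)
  have "- D = (\<Union>k\<in>{1..r}. (\<lambda>x. x - a k) ` of_int ` singular_values k)"
  proof -
    have "(x + a k \<in> of_int ` singular_values k) = (x \<in> (\<lambda>x. x - a k) ` of_int ` singular_values k)"
      for x k
      by (metis (no_types, lifting) add_diff_cancel_right' diff_add_cancel image_iff)
    then show ?thesis
      using last_sum_upd[of _ r s] by (auto simp: D_def regular_points_def sp simp flip: a_def)
  qed
  moreover have "closed ((\<lambda>x. x - a k) ` of_int ` singular_values k)" for k
    using closed_translation[OF closed_of_int_image[of "singular_values k"], of "- a k"]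
    by (simp add: image_image)
  ultimately have opD: "open D" and coD: "countable (- D)"
    by (auto simp: open_closed intro!: countable_UN)
  have "connected (UNIV - (- D))"
    using coD by (intro connected_open_diff_countable) auto
  then have conD: "connected D" by (simp add: Compl_eq_Diff_UNIV [symmetric])
  have E: "E = (\<Inter>k\<in>{1..r}. {z. Re z > real k - Re (a k)})"
    using last_sum_upd[of _ r s]
    by (auto simp: E_def convergence_region_def sp algebra_simps simp flip: a_def)
  have opE: "open E"
    unfolding E by (intro open_INT) (auto intro: open_halfspace_Re_gt)
  define M where "M = 1 + (\<Sum>k=1..r. \<bar>real k - Re (a k)\<bar>)"
  have "real k - Re (a k) < M" if "k \<in> {1..r}" for k
    using member_le_sum[of k "{1..r}" "\<lambda>k. \<bar>real k - Re (a k)\<bar>"] that by (auto simp: M_def)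
  then have neE: "of_real M \<in> E" by (auto simp: E)
  have ED: "E \<subseteq> D"
  proof
    fix z assume z: "z \<in> E"
    have "c \<le> int k" if "k \<in> {1..r}" "c \<in> singular_values k" for k c
      using that by (auto simp: singular_values_def split: if_splits)
    then have "Re (of_int c) \<le> real k" if "k \<in> {1..r}" "c \<in> singular_values k" for k c
      using that by (metis of_int_le_iff of_int_of_nat_eq complex_Re_of_int)
    then show "z \<in> D"
      using z by (fastforce simp: E_def D_def convergence_region_def regular_points_def)
  qed
  have "F (s(r := s r)) = G (s(r := s r))"
  proof (rule analytic_continuation_open[OF opE opD _ conD ED, of "\<lambda>z. F (s(r := z))" "\<lambda>z. G (s(r := z))"])
    show "E \<noteq> {}" using neE by auto
    show "(\<lambda>z. F (s(r := z))) holomorphic_on D" "(\<lambda>z. G (s(r := z))) holomorphic_on D"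
      using F G s r unfolding mzeta_continuation_def holomorphic_several_def D_def by auto
    show "F (s(r := z)) = G (s(r := z))" if "z \<in> E" for z
      using that F G by (auto simp: mzeta_continuation_def E_def)
    show "s r \<in> D" using s by (simp add: D_def)
  qed
  then show ?thesis by simp
qed

end

theory Submission
  imports Defs
begin

text \<open>
  Euler--Maclaurin summation over the last variable expresses \<open>(s\<^sub>r - 1) \<zeta>\<^sub>r(s)\<close> through the values
  \<open>\<zeta>\<^bsub>r-1\<^esub>(s\<^sub>1, \<dots>, s\<^bsub>r-1\<^esub> + s\<^sub>r + j - 1)\<close> with coefficients \<open>B\<^sub>j/j! (s\<^sub>r - 1)\<^sub>j\<close>, up to a series over \<open>m\<^sub>r\<close>
  that converges when the order is large. By induction on \<open>r\<close> this gives the continuation; the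
  vanishing of the odd Bernoulli numbers produces exactly the stated singular hyperplanes.

  At \<open>s\<^sub>r = -N\<close> the error series vanishes and only finitely many rational coefficients survive, which
  lowers the depth. If instead \<open>n\<^sub>r \<ge> 2\<close> and \<open>n\<^sub>i = -N \<le> 0\<close> for some \<open>i < r\<close>, the inner sum over
  \<open>m\<^bsub>i-1\<^esub> < m\<^sub>i < m\<^bsub>i+1\<^esub>\<close> is evaluated by Faulhaber's formula, which merges the \<open>i\<close>-th entry into one of
  its neighbours; the identity is transported to the regular points by analytic continuation in
  \<open>s\<^sub>r\<close>. Both reductions merge a nonpositive entry into a neighbour without increasing that
  neighbour, so the number and the sum of the positive entries do not grow, and they stop at an
  admissible index.
\<close>

section \<open>Bernoulli numbers and the Euler--Maclaurin error\<close>

text \<open>The order at which the error series converges grows with the size of the point, so no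
  fixed order gives the continuation at all regular points. The construction therefore runs over
  boxes \<open>coord_box\<close> with an order \<open>em_order\<close> for each, and the pieces are
  glued by a limit over the order, which is eventually constant at every point.

  Identities are first proved for sums truncated at \<open>M\<close>, where they are exact;
  convergence enters only when \<open>M\<close> tends to infinity. This is what allows two orders to
  be compared at points where the series itself diverges.

  Off the regular points the values of a continuation are arbitrary. A merged point with odd
  \<open>j > 1\<close> may be singular, and its term is harmless only because its coefficient
  vanishes; hence the recurring case split on the parity of \<open>j\<close>.

  The elimination of an inner entry continues analytically in the last variable, which must be free
  for that; a nonpositive last entry is evaluated by the formula for the continuation
  itself.\<close>

text \<open>\<open>todd_fps\<close> is \<open>X / (e\<^sup>X - 1)\<close>, so \<open>bern_coeff j\<close> is \<open>B\<^sub>j / j!\<close> with \<open>B\<^sub>1 = -1/2\<close>.\<close>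

definition todd_fps :: "rat fps" where
  "todd_fps = inverse (Abs_fps (\<lambda>n. 1 / fact (Suc n)))"

definition bern_coeff :: "nat \<Rightarrow> rat" where
  "bern_coeff j = fps_nth todd_fps j"

text \<open>Coefficient comparison in \<open>todd_fps * H = 1\<close>, where \<open>H\<close> is the
  series of \<open>(e^X - 1)/X\<close>. In \<open>em_error_eq\<close> this recursion cancels all
  powers of \<open>1/m\<close> up to the chosen order except the leading one.\<close>

lemma bern_coeff_convolution:
  "(\<Sum>j\<le>k. bern_coeff j / fact (Suc (k - j))) = (if k = 0 then 1 else 0)"
proof -
  define H :: "rat fps" where "H = Abs_fps (\<lambda>n. 1 / fact (Suc n))"
  have "fps_nth H 0 \<noteq> 0" by (simp add: H_def)
  then have "todd_fps * H = 1"
    unfolding todd_fps_def H_def by (intro inverse_mult_eq_1) simp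
  then have "fps_nth (todd_fps * H) k = fps_nth 1 k" by simp
  then show ?thesis
    by (simp add: fps_mult_nth bern_coeff_def H_def atLeast0AtMost)
qed

text \<open>\<open>T'\<close> and \<open>H'\<close> are the two series at \<open>-X\<close>. From
  \<open>(e^X - 1)/X = e^X (1 - e^(-X))/X\<close> one gets \<open>T' = todd_fps + X\<close>, and in
  odd degrees the two sides have opposite Bernoulli terms.\<close>

lemma bern_coeff_odd:
  assumes "odd j" "j \<noteq> 1"
  shows "bern_coeff j = 0"
proof -
  define H :: "rat fps" where "H = Abs_fps (\<lambda>n. 1 / fact (Suc n))"
  define H' :: "rat fps" where "H' = Abs_fps (\<lambda>n. (-1) ^ n / fact (Suc n))"
  define T' :: "rat fps" where "T' = Abs_fps (\<lambda>n. (-1) ^ n * bern_coeff n)"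
  have TH: "todd_fps * H = 1"
    unfolding todd_fps_def H_def by (intro inverse_mult_eq_1) simp
  have "fps_nth (T' * H') n = fps_nth 1 n" for n
  proof -
    have "fps_nth (T' * H') n = (\<Sum>i\<le>n. (-1) ^ n * (bern_coeff i / fact (Suc (n - i))))"
      unfolding fps_mult_nth T'_def H'_def atLeast0AtMost
      by (intro sum.cong) (auto simp: power_add[symmetric])
    also have "\<dots> = (-1) ^ n * (\<Sum>i\<le>n. bern_coeff i / fact (Suc (n - i)))"
      by (simp add: sum_distrib_left)
    finally show ?thesis unfolding bern_coeff_convolution by simp
  qed
  then have TH': "T' * H' = 1" by (simp add: fps_eq_iff)
  have XH: "fps_X * H = fps_exp 1 - 1"
  proof (rule fps_ext)
    fix n show "fps_nth (fps_X * H) n = fps_nth (fps_exp 1 - 1) n"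
      by (cases n) (auto simp: H_def fps_X_mult_nth simp del: fact_Suc)
  qed
  have XH': "fps_X * H' = 1 - fps_exp (-1)"
  proof (rule fps_ext)
    fix n show "fps_nth (fps_X * H') n = fps_nth (1 - fps_exp (-1)) n"
      by (cases n) (auto simp: H'_def fps_X_mult_nth simp del: fact_Suc)
  qed
  have "fps_exp 1 * fps_exp (-1) = (1 :: rat fps)"
    by (simp add: fps_exp_add_mult[symmetric])
  then have "fps_exp 1 * (1 - fps_exp (-1)) = fps_exp 1 - (1 :: rat fps)"
    by (simp add: algebra_simps)
  then have "fps_X * H = fps_X * (fps_exp 1 * H')"
    using XH XH' by (metis mult.left_commute)
  then have HH: "H = fps_exp 1 * H'" by simp
  have "T' = T' * (todd_fps * H)" by (simp add: TH)
  also have "\<dots> = todd_fps * fps_exp 1 * (T' * H')" unfolding HH by (simp add: algebra_simps)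
  also have "\<dots> = todd_fps * (1 + fps_X * H)" using TH' XH by simp
  also have "\<dots> = todd_fps + fps_X * (todd_fps * H)" by (simp add: algebra_simps)
  finally have "T' = todd_fps + fps_X" by (simp add: TH)
  then have "fps_nth T' j = fps_nth (todd_fps + fps_X) j" by simp
  then show ?thesis using assms by (simp add: T'_def bern_coeff_def)
qed

text \<open>Tail of the binomial series; it enters with \<open>x = 1/m\<close> when powers of
  \<open>m - 1 = m (1 - 1/m)\<close> are expanded around \<open>m\<close>.\<close>

definition binomial_remainder :: "complex \<Rightarrow> nat \<Rightarrow> real \<Rightarrow> complex" where
  "binomial_remainder a L x =
     of_real (1 - x) powr (- a) - (\<Sum>l<L. pochhammer a l / fact l * of_real x ^ l)"

lemma one_minus_powr_sums:
  assumes "\<bar>x\<bar> < 1"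
  shows "(\<lambda>l. pochhammer a l / fact l * of_real x ^ l) sums (of_real (1 - x) powr (- a :: complex))"
proof -
  have "(\<lambda>n. ((- a) gchoose n) * (- of_real x) ^ n) sums (1 + (- of_real x)) powr (- a)"
    by (rule gen_binomial_complex) (use assms in simp)
  moreover have "((- a) gchoose n) * (- of_real x) ^ n = pochhammer a n / fact n * of_real x ^ n" for n
  proof -
    have "((- a) gchoose n) * (- of_real x) ^ n
        = ((-1) ^ n * (-1) ^ n) * (pochhammer a n / fact n * of_real x ^ n)"
      unfolding gbinomial_pochhammer by (simp add: power_minus[of "of_real x"])
    also have "(-1 :: complex) ^ n * (-1) ^ n = 1" by (simp add: power_add[symmetric])
    finally show ?thesis by simp
  qed
  ultimately show ?thesis by simp
qed

lemma norm_pochhammer_le: "norm (pochhammer a n) \<le> pochhammer (norm (a :: complex)) n"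
proof -
  have "norm (a + of_nat i) \<le> norm a + real i" for i
    using norm_triangle_ineq[of a "of_nat i"] by simp
  then show ?thesis
    unfolding pochhammer_prod by (simp add: prod_norm[symmetric] prod_mono)
qed

lemma pochhammer_mono_real: "0 \<le> a \<Longrightarrow> a \<le> b \<Longrightarrow> pochhammer a n \<le> pochhammer (b :: real) n"
  unfolding pochhammer_prod by (intro prod_mono) auto

text \<open>Uniformity in \<open>a\<close> and \<open>x\<close> comes from domination:
  \<open>pochhammer a l\<close> is bounded by \<open>pochhammer A l\<close>, and once
  \<open>x ^ L\<close> is split off, the tail is bounded by the convergent series at
  \<open>x = 1/2\<close>.\<close>

lemma binomial_remainder_bound:
  "\<exists>C\<ge>0. \<forall>a x. norm a \<le> A \<longrightarrow> 0 \<le> x \<longrightarrow> x \<le> 1/2 \<longrightarrow> norm (binomial_remainder a L x) \<le> C * x ^ L"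
proof (cases "A \<ge> 0")
  case True
  define g where "g l = pochhammer A l / fact l" for l
  have "(\<lambda>l. pochhammer (of_real A) l / fact l * of_real (1/2) ^ l :: complex)
      sums (of_real (1 - 1/2) powr (- of_real A))"
    by (rule one_minus_powr_sums) simp
  then have "summable (\<lambda>l. of_real (g l * (1/2) ^ l) :: complex)"
    by (simp add: sums_iff g_def pochhammer_of_real)
  then have "summable (\<lambda>l. g l * (1/2) ^ l)" by (subst (asm) summable_complex_of_real)
  then have "summable (\<lambda>l. g (l + L) * (1/2) ^ (l + L))" by (subst summable_iff_shift)
  then have "summable (\<lambda>l. 2 ^ L * (g (l + L) * (1/2) ^ (l + L)))" by (rule summable_mult)
  moreover have "2 ^ L * (g (l + L) * (1/2) ^ (l + L)) = g (l + L) * (1/2) ^ l" for l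
    by (simp add: power_add power_one_over)
  ultimately have sg: "summable (\<lambda>l. g (l + L) * (1/2) ^ l)" by simp
  have g0: "g l \<ge> 0" for l using True unfolding g_def pochhammer_prod by (intro divide_nonneg_nonneg prod_nonneg) auto
  show ?thesis
  proof (intro exI[of _ "\<Sum>l. g (l + L) * (1/2) ^ l"] conjI allI impI)
    show "0 \<le> (\<Sum>l. g (l + L) * (1/2) ^ l)" using sg g0 by (intro suminf_nonneg) auto
    fix a :: complex and x :: real
    assume ax: "norm a \<le> A" "0 \<le> x" "x \<le> 1/2"
    define f where "f l = pochhammer a l / fact l * of_real x ^ l" for l
    have fs: "f sums (of_real (1 - x) powr (- a))"
      unfolding f_def by (rule one_minus_powr_sums) (use ax in auto)
    then have rem: "(\<lambda>l. f (l + L)) sums binomial_remainder a L x"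
      unfolding binomial_remainder_def using sums_iff_shift[of f L] f_def by simp
    have nf: "norm (f (l + L)) \<le> x ^ L * (g (l + L) * (1/2) ^ l)" for l
    proof -
      have "norm (f (l + L)) \<le> g (l + L) * x ^ (l + L)"
        unfolding f_def g_def norm_mult norm_divide norm_power
        using ax pochhammer_mono_real[of "norm a" A "l + L"] norm_pochhammer_le[of a "l + L"]
        by (auto intro!: mult_right_mono divide_right_mono)
      also have "\<dots> = x ^ L * (g (l + L) * x ^ l)" by (simp add: power_add)
      also have "\<dots> \<le> x ^ L * (g (l + L) * (1/2) ^ l)"
        using ax g0 by (intro mult_left_mono power_mono) auto
      finally show ?thesis .
    qed
    have "norm (binomial_remainder a L x) = norm (\<Sum>l. f (l + L))" using rem by (simp add: sums_iff)
    also have "\<dots> \<le> (\<Sum>l. x ^ L * (g (l + L) * (1/2) ^ l))"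
      by (rule norm_suminf_le[OF nf]) (use sg in \<open>rule summable_mult\<close>)
    also have "\<dots> = (\<Sum>l. g (l + L) * (1/2) ^ l) * x ^ L" by (simp add: suminf_mult sg)
    finally show "norm (binomial_remainder a L x) \<le> (\<Sum>l. g (l + L) * (1/2) ^ l) * x ^ L" .
  qed
next
  case False
  then show ?thesis
    by (intro exI[of _ 0]) (auto dest: order_trans[OF norm_ge_zero])
qed

text \<open>The binomial series of \<open>(1 - x)^k\<close> stops at degree
  \<open>k\<close>.\<close>

lemma binomial_remainder_neg_nat:
  assumes "k < L" "0 \<le> x" "x < 1"
  shows "binomial_remainder (- of_nat k) L x = 0"
proof -
  have "(\<lambda>l. pochhammer (- of_nat k) l / fact l * of_real x ^ l) sums
      (\<Sum>l<L. pochhammer (- of_nat k :: complex) l / fact l * of_real x ^ l)"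
    by (rule sums_finite) (use assms in \<open>auto simp: pochhammer_of_nat_eq_0_iff\<close>)
  moreover have "(\<lambda>l. pochhammer (- of_nat k) l / fact l * of_real x ^ l) sums
      (of_real (1 - x) powr (- (- of_nat k) :: complex))"
    by (rule one_minus_powr_sums) (use assms in auto)
  ultimately show ?thesis
    unfolding binomial_remainder_def by (simp add: sums_unique2)
qed

lemma of_rat_fact: "of_rat (fact n) = (fact n :: complex)"
  by (metis of_nat_fact of_rat_of_nat_eq)

text \<open>\<open>em_term J s x / (s - 1)\<close> is the Euler--Maclaurin approximation of \<open>\<Sum>m>x. m\<^bsup>-s\<^esup>\<close> and \<open>em_error\<close> is the
  defect of its telescoping; the factor \<open>s - 1\<close> is cleared so that all of them are entire in \<open>s\<close>.\<close>

definition em_coeff :: "complex \<Rightarrow> nat \<Rightarrow> complex" where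
  "em_coeff s j = of_rat (bern_coeff j) * pochhammer (s - 1) j"

definition em_term :: "nat \<Rightarrow> complex \<Rightarrow> nat \<Rightarrow> complex" where
  "em_term J s x = (\<Sum>j\<le>J. em_coeff s j * of_nat x powr (1 - s - of_nat j))"

definition em_error :: "nat \<Rightarrow> complex \<Rightarrow> nat \<Rightarrow> complex" where
  "em_error J s m = (s - 1) * of_nat m powr (- s) - em_term J s (m - 1) + em_term J s m"

text \<open>In \<open>em_term J s (m - 1)\<close> the \<open>j\<close>-th power is expanded at
  \<open>m\<close> up to degree \<open>J + 1 - j\<close>, so that all retained terms have total
  degree at most \<open>J + 1\<close>. Degree zero of the expansion cancels
  \<open>em_term J s m\<close>, the other retained terms add up to \<open>(s - 1) m^(-s)\<close>
  (this is \<open>main\<close>), and only the tails remain.\<close>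

lemma em_error_eq:
  assumes "m \<ge> 2"
  shows "em_error J s m = - (\<Sum>j\<le>J. em_coeff s j * of_nat m powr (1 - s - of_nat j) *
           binomial_remainder (s - 1 + of_nat j) (J + 2 - j) (1 / real m))"
proof -
  define x where "x = 1 / real m"
  define w where "w j = of_nat m powr (1 - s - of_nat j)" for j :: nat
  define q where "q j l = pochhammer (s - 1 + of_nat j) l / fact l * of_real x ^ l" for j l
  have m0: "(of_nat m :: complex) \<noteq> 0" using assms by auto
  have pw: "of_nat (m - 1) powr (1 - s - of_nat j) = w j * of_real (1 - x) powr (- (s - 1 + of_nat j))" for j
  proof -
    have e: "(of_nat (m - 1) :: complex) = of_real (real m) * of_real (1 - x)"
      using assms by (simp add: x_def field_simps of_nat_diff)
    have "of_nat (m - 1) powr (1 - s - of_nat j)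
        = of_real (real m) powr (1 - s - of_nat j) * of_real (1 - x) powr (1 - s - of_nat j)"
      unfolding e by (rule powr_times_real) (use assms in \<open>auto simp: x_def\<close>)
    then show ?thesis by (simp add: w_def algebra_simps)
  qed
  have wl: "w j * of_real x ^ l = w (j + l)" for j l
  proof -
    have "w (j + l) = of_nat m powr (1 - s - of_nat j) * of_nat m powr (- of_nat l)"
      unfolding w_def powr_add[symmetric] by (simp add: algebra_simps)
    also have "(of_nat m :: complex) powr (- of_nat l) = of_real x ^ l"
      using m0 by (simp add: powr_minus powr_nat x_def power_one_over divide_inverse power_inverse)
    finally show ?thesis by (simp add: w_def)
  qed
  have split: "of_real (1 - x) powr (- (s - 1 + of_nat j)) =
      1 + (\<Sum>l\<le>J - j. q j (Suc l)) + binomial_remainder (s - 1 + of_nat j) (J + 2 - j) x"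
    if "j \<le> J" for j
  proof -
    have "(\<Sum>l<J + 2 - j. q j l) = (\<Sum>l<Suc (Suc (J - j)). q j l)"
      using that by (simp add: Suc_diff_le)
    also have "\<dots> = q j 0 + (\<Sum>l\<le>J - j. q j (Suc l))"
      by (subst sum.lessThan_Suc_shift) (simp only: lessThan_Suc_atMost)
    finally show ?thesis by (simp add: binomial_remainder_def q_def)
  qed
  have main: "(\<Sum>j\<le>J. em_coeff s j * w j * (\<Sum>l\<le>J - j. q j (Suc l))) = (s - 1) * of_nat m powr (- s)"
  proof -
    \<comment> \<open>Apart from the Bernoulli coefficient and the factorial, everything depends on
      \<open>j + l\<close> only. Collecting the terms with \<open>j + l = k\<close> therefore
      produces the Bernoulli convolution, which vanishes unless \<open>k = 0\<close>.\<close>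
    define g where "g j l = of_rat (bern_coeff j) / fact (Suc l) * (pochhammer (s - 1) (Suc (j + l)) * w (Suc (j + l)))"
      for j l
    have "em_coeff s j * w j * q j (Suc l) = g j l" for j l
    proof -
      have "em_coeff s j * w j * q j (Suc l)
          = of_rat (bern_coeff j) / fact (Suc l) * ((pochhammer (s - 1) j * pochhammer (s - 1 + of_nat j) (Suc l))
             * (w j * of_real x ^ Suc l))"
        by (simp add: em_coeff_def q_def)
      also have "pochhammer (s - 1) j * pochhammer (s - 1 + of_nat j) (Suc l) = pochhammer (s - 1) (j + Suc l)"
        by (simp only: pochhammer_product')
      finally show ?thesis unfolding wl by (simp add: g_def)
    qed
    then have "(\<Sum>j\<le>J. em_coeff s j * w j * (\<Sum>l\<le>J - j. q j (Suc l))) = (\<Sum>j\<le>J. \<Sum>l\<le>J - j. g j l)"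
      by (simp only: sum_distrib_left)
    also have "\<dots> = (\<Sum>(j, l)\<in>{(j, l). j + l \<le> J}. g j l)"
      by (subst sum.Sigma) (auto intro!: sum.cong)
    also have "\<dots> = (\<Sum>k\<le>J. \<Sum>j\<le>k. g j (k - j))" by (rule sum.triangle_reindex_eq)
    also have "\<dots> = (\<Sum>k\<le>J. if k = 0 then (s - 1) * of_nat m powr (- s) else 0)"
    proof (rule sum.cong[OF refl])
      fix k
      have "(\<Sum>j\<le>k. g j (k - j)) =
          (\<Sum>j\<le>k. of_rat (bern_coeff j / fact (Suc (k - j))) * (pochhammer (s - 1) (Suc k) * w (Suc k)))"
        by (intro sum.cong) (auto simp: g_def of_rat_divide of_rat_fact simp del: fact_Suc)
      also have "\<dots> = of_rat (\<Sum>j\<le>k. bern_coeff j / fact (Suc (k - j))) * (pochhammer (s - 1) (Suc k) * w (Suc k))"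
        by (simp only: sum_distrib_right of_rat_sum)
      finally show "(\<Sum>j\<le>k. g j (k - j)) = (if k = 0 then (s - 1) * of_nat m powr (- s) else 0)"
        unfolding bern_coeff_convolution by (simp add: w_def)
    qed
    finally show ?thesis by simp
  qed
  have "em_error J s m = (s - 1) * of_nat m powr (- s)
      - (\<Sum>j\<le>J. em_coeff s j * w j * of_real (1 - x) powr (- (s - 1 + of_nat j)))
      + (\<Sum>j\<le>J. em_coeff s j * w j)"
    unfolding em_error_def em_term_def pw by (simp add: w_def mult.assoc)
  also have "(\<Sum>j\<le>J. em_coeff s j * w j * of_real (1 - x) powr (- (s - 1 + of_nat j))) =
     (\<Sum>j\<le>J. em_coeff s j * w j + em_coeff s j * w j * (\<Sum>l\<le>J - j. q j (Suc l))
        + em_coeff s j * w j * binomial_remainder (s - 1 + of_nat j) (J + 2 - j) x)"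
    by (intro sum.cong refl) (subst split, auto simp: distrib_left)
  finally show ?thesis
    unfolding sum.distrib main by (simp add: w_def x_def)
qed

text \<open>Each tail contributes \<open>m^(1 - s - j) m^(-(J + 2 - j)) = m^(-s - J - 1)\<close>,
  the same power for all \<open>j\<close>, and \<open>- Re s \<le> B\<close>. The constant
  \<open>A\<close> bounds all parameters \<open>s - 1 + j\<close> with
  \<open>j \<le> J\<close>.\<close>

lemma em_error_bound:
  fixes B J :: nat
  assumes "B \<le> J"
  shows "\<exists>C\<ge>0. \<forall>s m. norm s \<le> real B \<longrightarrow> m \<ge> 2 \<longrightarrow> norm (em_error J s m) \<le> C / real m ^ (J + 1 - B)"
proof -
  define A where "A = real B + 1 + real J"
  obtain R where R0: "\<And>j. R j \<ge> 0"
    and R: "\<And>j a x. norm a \<le> A \<Longrightarrow> 0 \<le> x \<Longrightarrow> x \<le> 1/2 \<Longrightarrow> norm (binomial_remainder a (J + 2 - j) x) \<le> R j * x ^ (J + 2 - j)"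
  proof -
    have "\<exists>R. \<forall>j. R j \<ge> 0 \<and> (\<forall>a x. norm a \<le> A \<longrightarrow> 0 \<le> x \<longrightarrow> x \<le> 1/2 \<longrightarrow>
        norm (binomial_remainder a (J + 2 - j) x) \<le> R j * x ^ (J + 2 - j))"
      using binomial_remainder_bound[of A] by (intro choice) auto
    then show ?thesis using that by blast
  qed
  define D where "D j = norm (of_rat (bern_coeff j) :: complex) * pochhammer A j * R j" for j
  have A0: "A \<ge> 0" by (simp add: A_def)
  have D0: "D j \<ge> 0" for j unfolding D_def using A0 R0 unfolding pochhammer_prod
    by (intro mult_nonneg_nonneg prod_nonneg) auto
  show ?thesis
  proof (intro exI[of _ "\<Sum>j\<le>J. D j"] conjI allI impI)
    show "0 \<le> (\<Sum>j\<le>J. D j)" by (intro sum_nonneg D0)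
    fix s :: complex and m :: nat
    assume s: "norm s \<le> real B" and m: "m \<ge> 2"
    have "norm (em_coeff s j * of_nat m powr (1 - s - of_nat j) *
           binomial_remainder (s - 1 + of_nat j) (J + 2 - j) (1 / real m)) \<le> D j / real m ^ (J + 1 - B)"
      if j: "j \<le> J" for j
    proof -
      have a1: "norm (s - 1) \<le> A" using s norm_triangle_ineq4[of s 1] by (simp add: A_def)
      have a2: "norm (s - 1 + of_nat j) \<le> A"
        using norm_triangle_ineq[of "s - 1" "of_nat j"] norm_triangle_ineq4[of s 1] s j by (simp add: A_def)
      have 1: "norm (em_coeff s j) \<le> norm (of_rat (bern_coeff j) :: complex) * pochhammer A j"
        unfolding em_coeff_def norm_mult
        using norm_pochhammer_le[of "s - 1" j] pochhammer_mono_real[OF _ a1, of j]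
        by (intro mult_left_mono) auto
      have 2: "norm (binomial_remainder (s - 1 + of_nat j) (J + 2 - j) (1 / real m)) \<le> R j * (1 / real m) ^ (J + 2 - j)"
        by (rule R[OF a2]) (use m in auto)
      have 3: "norm ((of_nat m :: complex) powr (1 - s - of_nat j)) \<le> real m powr (1 + real B - real j)"
      proof -
        have "norm ((of_nat m :: complex) powr (1 - s - of_nat j)) = real m powr (1 - Re s - real j)"
          using norm_powr_real_powr[of "of_nat m" "1 - s - of_nat j"] by simp
        also have "\<dots> \<le> real m powr (1 + real B - real j)"
          using m s abs_Re_le_cmod[of s] by (intro powr_mono) auto
        finally show ?thesis .
      qed
      have "norm (em_coeff s j * of_nat m powr (1 - s - of_nat j) *
           binomial_remainder (s - 1 + of_nat j) (J + 2 - j) (1 / real m))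
          \<le> (norm (of_rat (bern_coeff j) :: complex) * pochhammer A j) * real m powr (1 + real B - real j)
             * (R j * (1 / real m) ^ (J + 2 - j))"
        unfolding norm_mult
        by (intro mult_mono 1 2 3 mult_nonneg_nonneg) (use A0 in \<open>auto simp: pochhammer_prod intro!: prod_nonneg\<close>)
      also have "\<dots> = D j * (real m powr (1 + real B - real j) * (1 / real m) ^ (J + 2 - j))"
        by (simp add: D_def)
      also have "(1 / real m) ^ (J + 2 - j) = real m powr (- real (J + 2 - j))"
        using m by (simp add: powr_minus powr_realpow power_inverse divide_inverse del: diff_Suc_Suc add_2_eq_Suc')
      also have "real m powr (1 + real B - real j) * real m powr (- real (J + 2 - j)) = real m powr (- real (J + 1 - B))"
        unfolding powr_add[symmetric] using j assms by (intro arg_cong[of _ _ "\<lambda>x. real m powr x"]) (simp add: of_nat_diff)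
      also have "\<dots> = 1 / real m ^ (J + 1 - B)"
        using m by (simp add: powr_minus powr_realpow divide_inverse)
      finally show ?thesis by simp
    qed
    then have "norm (em_error J s m) \<le> (\<Sum>j\<le>J. D j / real m ^ (J + 1 - B))"
      unfolding em_error_eq[OF m] norm_minus_cancel by (intro sum_norm_le) auto
    then show "norm (em_error J s m) \<le> (\<Sum>j\<le>J. D j) / real m ^ (J + 1 - B)"
      by (simp add: sum_divide_distrib)
  qed
qed

lemma em_coeff_neg_nat: "j > Suc N \<Longrightarrow> em_coeff (- of_nat N) j = 0"
proof -
  assume "j > Suc N"
  have "pochhammer (- of_nat N - 1 :: complex) j = pochhammer (- of_nat (Suc N)) j"
    by (rule arg_cong[where f = "\<lambda>x. pochhammer x j"]) simp
  also have "\<dots> = 0" using \<open>j > Suc N\<close> by (subst pochhammer_of_nat_eq_0_iff)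
  finally show ?thesis by (simp add: em_coeff_def)
qed

text \<open>Faulhaber's case, where the telescoping is exact. For \<open>j \<le> N + 1\<close> the
  parameter \<open>s - 1 + j\<close> is minus the natural number \<open>N + 1 - j\<close>, which
  lies below the cutoff \<open>J + 2 - j\<close>, so the tail is zero; for larger \<open>j\<close>
  the coefficient is zero.\<close>

lemma em_error_neg_nat:
  assumes "m \<ge> 2" "N \<le> J"
  shows "em_error J (- of_nat N) m = 0"
proof -
  have "em_coeff (- of_nat N) j * of_nat m powr (1 - (- of_nat N) - of_nat j) *
      binomial_remainder ((- of_nat N) - 1 + of_nat j) (J + 2 - j) (1 / real m) = 0" if "j \<le> J" for j
  proof (cases "j > Suc N")
    case False
    have "(- of_nat N) - 1 + of_nat j = (- of_nat (Suc N - j) :: complex)"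
      using False by (simp add: of_nat_diff)
    moreover have "binomial_remainder (- of_nat (Suc N - j)) (J + 2 - j) (1 / real m) = 0"
      by (rule binomial_remainder_neg_nat) (use that assms False in auto)
    ultimately show ?thesis by (simp only: mult_zero_right)
  qed (simp add: em_coeff_neg_nat)
  then show ?thesis
    unfolding em_error_eq[OF assms(1)] neg_equal_0_iff_equal by (intro sum.neutral) blast
qed

section \<open>Truncated multiple zeta sums\<close>

text \<open>The truncation of the multiple zeta series to \<open>0 < m\<^sub>1 < \<dots> < m\<^sub>r \<le> M\<close>.\<close>

primrec mzpart :: "nat \<Rightarrow> (nat \<Rightarrow> 'a :: {real_normed_field, ln}) \<Rightarrow> nat \<Rightarrow> 'a" where
  "mzpart 0 s M = 1"
| "mzpart (Suc r) s M = (\<Sum>m=1..M. of_nat m powr (- s (Suc r)) * mzpart r s (m - 1))"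

lemma mzpart_cong: "(\<And>i. i \<in> {1..r} \<Longrightarrow> s i = t i) \<Longrightarrow> mzpart r s M = mzpart r t M"
proof (induction r arbitrary: M)
  case (Suc r)
  then have "mzpart r s N = mzpart r t N" for N by auto
  then show ?case using Suc.prems[of "Suc r"] by simp
qed simp

lemma mzpart_Suc_Suc:
  "mzpart (Suc r) s (Suc M) = mzpart (Suc r) s M + of_nat (Suc M) powr (- s (Suc r)) * mzpart r s M"
  by (simp del: of_nat_Suc)

lemma mzpart_nonneg: "0 \<le> mzpart r (s :: nat \<Rightarrow> real) M"
  by (induction r arbitrary: M) (auto intro!: sum_nonneg)

lemma mzpart_mono:
  assumes "M \<le> N"
  shows "mzpart r (s :: nat \<Rightarrow> real) M \<le> mzpart r s N"
  using assms by (cases r) (auto intro!: sum_mono2 mult_nonneg_nonneg mzpart_nonneg)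

lemma norm_mzpart_le: "norm (mzpart r s M) \<le> mzpart r (\<lambda>i. Re (s i)) M"
proof (induction r arbitrary: M)
  case (Suc r)
  have "norm (of_nat m powr (- s (Suc r)) * mzpart r s (m - 1)) \<le>
      of_nat m powr (- Re (s (Suc r))) * mzpart r (\<lambda>i. Re (s i)) (m - 1)" for m
    unfolding norm_mult using norm_powr_real_powr[of "of_nat m" "- s (Suc r)"]
    by (auto intro!: mult_mono Suc)
  then show ?case by (auto intro: sum_norm_le)
qed simp

text \<open>Each of the \<open>r\<close> nested sums has at most \<open>M\<close> terms, with a
  factor of size at most \<open>M^B\<close>. Such a crude polynomial bound suffices because the
  decay of \<open>em_error\<close> can be made as fast as desired.\<close>

lemma norm_mzpart_le_power:
  fixes s :: "nat \<Rightarrow> complex"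
  assumes "\<And>i. i \<in> {1..r} \<Longrightarrow> norm (s i) \<le> real B" "M \<ge> 1"
  shows "norm (mzpart r s M) \<le> real M ^ (r * (B + 1))"
  using assms
proof (induction r arbitrary: M)
  case (Suc r)
  have b: "norm (of_nat m powr (- s (Suc r)) * mzpart r s (m - 1)) \<le> real M ^ B * real M ^ (r * (B + 1))"
    if m: "m \<in> {1..M}" for m
  proof -
    have "norm (of_nat m powr (- s (Suc r))) = real m powr (- Re (s (Suc r)))"
      using norm_powr_real_powr[of "of_nat m" "- s (Suc r)"] by simp
    also have "\<dots> \<le> real m powr real B"
      using m Suc.prems(1)[of "Suc r"] abs_Re_le_cmod[of "s (Suc r)"] by (intro powr_mono) auto
    also have "\<dots> = real m ^ B" using m by (intro powr_realpow) simp
    also have "\<dots> \<le> real M ^ B" using m by (intro power_mono) auto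
    finally have 1: "norm (of_nat m powr (- s (Suc r))) \<le> real M ^ B" .
    have 2: "norm (mzpart r s (m - 1)) \<le> real M ^ (r * (B + 1))"
    proof (cases "m = 1")
      case True
      have "mzpart r s 0 = (if r = 0 then 1 else 0)" by (cases r) auto
      then have "norm (mzpart r s 0) \<le> 1" by simp
      also have "1 \<le> real M ^ (r * (B + 1))" using Suc.prems(2) by (intro one_le_power) simp
      finally show ?thesis using True by simp
    next
      case False
      have "norm (mzpart r s (m - 1)) \<le> real (m - 1) ^ (r * (B + 1))"
        by (rule Suc.IH) (use False m Suc.prems(1) in auto)
      also have "\<dots> \<le> real M ^ (r * (B + 1))" using m by (intro power_mono) auto
      finally show ?thesis .
    qed
    show ?thesis unfolding norm_mult by (intro mult_mono 1 2) auto
  qed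
  have "norm (mzpart (Suc r) s M) \<le> (\<Sum>m=1..M. real M ^ B * real M ^ (r * (B + 1)))"
    unfolding mzpart.simps by (intro sum_norm_le b)
  also have "\<dots> = real M * real M ^ B * real M ^ (r * (B + 1))" by simp
  also have "\<dots> = real M ^ (1 + B + r * (B + 1))" by (simp only: power_add power_one_right)
  also have "1 + B + r * (B + 1) = Suc r * (B + 1)" by simp
  finally show ?case .
qed simp

lemma mzpart_shift_last:
  assumes "\<rho> \<ge> 0"
  shows "real M powr (- \<rho>) * mzpart (Suc r) s M \<le> mzpart (Suc r) (s(Suc r := s (Suc r) + \<rho>)) M"
proof -
  have "real M powr (- \<rho>) * (real m powr (- s (Suc r)) * mzpart r s (m - 1))
      \<le> real m powr (- (s (Suc r) + \<rho>)) * mzpart r s (m - 1)" if "m \<in> {1..M}" for m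
  proof -
    have "real M powr (- \<rho>) \<le> real m powr (- \<rho>)"
      using that assms by (intro powr_mono2') auto
    then have "real M powr (- \<rho>) * (real m powr (- s (Suc r)) * mzpart r s (m - 1))
        \<le> real m powr (- \<rho>) * (real m powr (- s (Suc r)) * mzpart r s (m - 1))"
      by (intro mult_right_mono mult_nonneg_nonneg mzpart_nonneg) auto
    also have "\<dots> = real m powr (- (s (Suc r) + \<rho>)) * mzpart r s (m - 1)"
      by (simp add: powr_add[symmetric] mult.assoc[symmetric] add.commute)
    finally show ?thesis .
  qed
  moreover have "mzpart r (s(Suc r := s (Suc r) + \<rho>)) M = mzpart r s M" for M
    by (rule mzpart_cong) auto
  ultimately show ?thesis by (auto simp: sum_distrib_left intro!: sum_mono)
qed

lemma last_sum_eq: "k \<le> r \<Longrightarrow> last_sum r k s = sum s {r - k<..r}"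
  unfolding last_sum_def
  by (rule sum.reindex_bij_witness[of _ "\<lambda>i. r + 1 - i" "\<lambda>i. r - i + 1"]) auto

lemma last_sum_Suc_Suc: "k \<le> r \<Longrightarrow> last_sum (Suc r) (Suc k) s = s (Suc r) + last_sum r k s"
proof -
  assume "k \<le> r"
  then have "{Suc r - Suc k<..Suc r} = insert (Suc r) {r - k<..r}" by auto
  then show ?thesis using \<open>k \<le> r\<close> by (simp add: last_sum_eq)
qed

lemma last_sum_1: "r \<ge> 1 \<Longrightarrow> last_sum r 1 s = s r"
  by (simp add: last_sum_def)

lemma last_sum_upd_real:
  assumes "k \<in> {1..r}"
  shows "last_sum r k (s(r := s r + \<rho>)) = last_sum r k s + (\<rho> :: real)"
proof -
  have e: "{r - k<..r} = insert r {r - k<..<r}" using assms by auto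
  have "sum (s(r := s r + \<rho>)) {r - k<..<r} = sum s {r - k<..<r}"
    by (rule sum.cong) auto
  then show ?thesis using assms by (simp add: last_sum_eq e)
qed

text \<open>Since \<open>m\<^sub>r < m\<^bsub>r+1\<^esub>\<close>, the part of the last exponent in excess of \<open>1 + \<eta>\<close> may be moved to the previous
  variable, which leaves a product of convergent one-variable sums.\<close>

lemma mzpart_bounded:
  fixes s :: "nat \<Rightarrow> real"
  assumes \<eta>: "\<eta> > 0" and C: "\<And>M. (\<Sum>m=1..M. real m powr (- (1 + \<eta>))) \<le> C"
  shows "(\<And>k. k \<in> {1..r} \<Longrightarrow> last_sum r k s \<ge> real k * (1 + \<eta>)) \<Longrightarrow> mzpart r s M \<le> C ^ r"
    and "(\<And>k. k \<in> {1..Suc r} \<Longrightarrow> last_sum (Suc r) k s \<ge> real k * (1 + \<eta>)) \<Longrightarrow>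
           real M powr (1 + \<eta> - s (Suc r)) * mzpart r s M \<le> C ^ r"
proof -
  have C0: "C \<ge> 0" using C[of 0] by simp
  \<comment> \<open>The two claims are proved alternately: \<open>Q\<close> at depth
    \<open>r\<close> uses the bound at depth \<open>r\<close>, and the bound at depth
    \<open>r + 1\<close> uses \<open>Q\<close> at depth \<open>r\<close>. Hence the bound appears
    here as a premise.\<close>
  have Q: "real M powr (1 + \<eta> - s (Suc r)) * mzpart r s M \<le> C ^ r"
    if IH: "\<And>s. (\<And>k. k \<in> {1..r} \<Longrightarrow> last_sum r k s \<ge> real k * (1 + \<eta>)) \<Longrightarrow> mzpart r s M \<le> C ^ r"
      and hs: "\<And>k. k \<in> {1..Suc r} \<Longrightarrow> last_sum (Suc r) k s \<ge> real k * (1 + \<eta>)"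
    for r M and s :: "nat \<Rightarrow> real"
  proof (cases r)
    case 0
    have "s (Suc r) \<ge> 1 + \<eta>" using hs[of 1] 0 by (simp add: last_sum_1[of "Suc 0", simplified])
    then have "real M powr (1 + \<eta> - s (Suc r)) \<le> 1"
      using powr_mono[of "1 + \<eta> - s (Suc r)" 0 "real M"] by (cases "M = 0") auto
    then show ?thesis using 0 by simp
  next
    case (Suc q)
    define \<rho> where "\<rho> = s (Suc r) - (1 + \<eta>)"
    have \<rho>: "\<rho> \<ge> 0" using hs[of 1] by (simp add: \<rho>_def last_sum_def)
    have "real M powr (- \<rho>) * mzpart r s M \<le> mzpart r (s(r := s r + \<rho>)) M"
      unfolding Suc by (rule mzpart_shift_last[OF \<rho>])
    also have "\<dots> \<le> C ^ r"
    proof (rule IH)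
      fix k assume k: "k \<in> {1..r}"
      have "last_sum r k (s(r := s r + \<rho>)) = last_sum (Suc r) (Suc k) s - (1 + \<eta>)"
        using k by (simp add: last_sum_upd_real last_sum_Suc_Suc \<rho>_def)
      then show "real k * (1 + \<eta>) \<le> last_sum r k (s(r := s r + \<rho>))"
        using hs[of "Suc k"] k by (simp add: algebra_simps)
    qed
    finally show ?thesis by (simp add: \<rho>_def)
  qed
  have P: "mzpart r s M \<le> C ^ r"
    if "\<And>k. k \<in> {1..r} \<Longrightarrow> last_sum r k s \<ge> real k * (1 + \<eta>)" for r M and s :: "nat \<Rightarrow> real"
    using that
  proof (induction r arbitrary: s M)
    case (Suc r)
    have "real m powr (- s (Suc r)) * mzpart r s (m - 1) \<le> real m powr (- (1 + \<eta>)) * C ^ r"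
      if m: "m \<in> {1..M}" for m
    proof -
      have "real m powr (- s (Suc r)) * mzpart r s (m - 1) \<le> real m powr (- s (Suc r)) * mzpart r s m"
        by (intro mult_left_mono mzpart_mono) auto
      also have "\<dots> = real m powr (- (1 + \<eta>)) * (real m powr (1 + \<eta> - s (Suc r)) * mzpart r s m)"
        by (simp add: mult.assoc[symmetric] powr_add[symmetric])
      also have "\<dots> \<le> real m powr (- (1 + \<eta>)) * C ^ r"
        by (intro mult_left_mono Q[OF Suc.IH]) (use Suc.prems in auto)
      finally show ?thesis .
    qed
    then have "mzpart (Suc r) s M \<le> (\<Sum>m=1..M. real m powr (- (1 + \<eta>)) * C ^ r)"
      by (auto intro: sum_mono)
    also have "\<dots> = (\<Sum>m=1..M. real m powr (- (1 + \<eta>))) * C ^ r" by (simp add: sum_distrib_right)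
    also have "\<dots> \<le> C * C ^ r" by (intro mult_right_mono C zero_le_power C0)
    finally show ?case by simp
  qed simp
  show "(\<And>k. k \<in> {1..r} \<Longrightarrow> last_sum r k s \<ge> real k * (1 + \<eta>)) \<Longrightarrow> mzpart r s M \<le> C ^ r"
    by (rule P)
  show "(\<And>k. k \<in> {1..Suc r} \<Longrightarrow> last_sum (Suc r) k s \<ge> real k * (1 + \<eta>)) \<Longrightarrow>
           real M powr (1 + \<eta> - s (Suc r)) * mzpart r s M \<le> C ^ r"
    by (rule Q[OF P])
qed

lemma zeta_partial_bounded:
  assumes "\<eta> > 0"
  obtains C where "\<And>M. (\<Sum>m=1..M. real m powr (- (1 + \<eta>))) \<le> C"
proof -
  have s: "summable (\<lambda>m. real m powr (- (1 + \<eta>)))"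
    using assms by (simp add: summable_real_powr_iff)
  have "(\<Sum>m=1..M. real m powr (- (1 + \<eta>))) \<le> (\<Sum>m. real m powr (- (1 + \<eta>)))" for M
    by (rule sum_le_suminf[OF s]) auto
  then show ?thesis by (rule that)
qed

lemma last_sum_Re: "last_sum r k (\<lambda>i. Re (s i)) = Re (last_sum r k s)"
  by (simp add: last_sum_def)

text \<open>Finitely many strict inequalities leave a positive relative slack. The \<open>1\<close>
  inserted into \<open>E\<close> keeps the minimum meaningful for \<open>r = 0\<close>.\<close>

lemma convergence_region_margin:
  assumes "s \<in> convergence_region r"
  obtains \<eta> where "\<eta> > 0" "\<And>k. k \<in> {1..r} \<Longrightarrow> last_sum r k (\<lambda>i. Re (s i)) \<ge> real k * (1 + \<eta>)"
proof -
  define E where "E = insert 1 ((\<lambda>k. (Re (last_sum r k s) - real k) / real k) ` {1..r})"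
  have E: "finite E" "E \<noteq> {}" by (auto simp: E_def)
  have "Min E > 0"
    using assms E by (auto simp: E_def convergence_region_def)
  moreover have "last_sum r k (\<lambda>i. Re (s i)) \<ge> real k * (1 + Min E)" if k: "k \<in> {1..r}" for k
  proof -
    have "Min E \<le> (Re (last_sum r k s) - real k) / real k"
      using E k by (intro Min_le) (auto simp: E_def)
    then have "real k * Min E \<le> Re (last_sum r k s) - real k"
      using k by (simp add: pos_le_divide_eq mult.commute)
    then show ?thesis by (simp add: last_sum_Re algebra_simps)
  qed
  ultimately show ?thesis by (rule that)
qed

text \<open>The margin \<open>\<eta>\<close> survives as a factor \<open>M^(-\<eta>)\<close> in
  front of a quantity bounded by \<open>mzpart_bounded(2)\<close>. The exponent \<open>z\<close> may
  exceed the last coordinate because the boundary terms of all orders \<open>j\<close> have to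
  disappear.\<close>

lemma mzpart_boundary_tendsto_0:
  assumes "s \<in> convergence_region (Suc r)" "Re z \<ge> Re (s (Suc r))"
  shows "(\<lambda>M. of_nat M powr (1 - z) * mzpart r s M) \<longlonglongrightarrow> 0"
proof -
  obtain \<eta> where \<eta>: "\<eta> > 0"
    "\<And>k. k \<in> {1..Suc r} \<Longrightarrow> last_sum (Suc r) k (\<lambda>i. Re (s i)) \<ge> real k * (1 + \<eta>)"
    using convergence_region_margin[OF assms(1)] by blast
  obtain C where C: "\<And>M. (\<Sum>m=1..M. real m powr (- (1 + \<eta>))) \<le> C"
    using zeta_partial_bounded[OF \<eta>(1)] by blast
  show ?thesis
  proof (rule Lim_null_comparison)
    show "\<forall>\<^sub>F M in sequentially. norm (of_nat M powr (1 - z) * mzpart r s M) \<le> C ^ r * real M powr (- \<eta>)"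
    proof (rule eventually_mono[OF eventually_gt_at_top[of 0]])
      fix M :: nat assume M: "M > 0"
      have "norm (of_nat M powr (1 - z) * mzpart r s M) \<le> real M powr (1 - Re z) * mzpart r (\<lambda>i. Re (s i)) M"
        unfolding norm_mult using norm_powr_real_powr[of "of_nat M" "1 - z"]
        by (intro mult_mono norm_mzpart_le) auto
      also have "\<dots> \<le> real M powr (1 - Re (s (Suc r))) * mzpart r (\<lambda>i. Re (s i)) M"
        using assms(2) M by (intro mult_right_mono powr_mono mzpart_nonneg) auto
      also have "\<dots> = real M powr (- \<eta>) * (real M powr (1 + \<eta> - Re (s (Suc r))) * mzpart r (\<lambda>i. Re (s i)) M)"
        by (simp add: mult.assoc[symmetric] powr_add[symmetric])
      also have "\<dots> \<le> real M powr (- \<eta>) * C ^ r"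
        by (intro mult_left_mono mzpart_bounded(2)[OF \<eta>(1) C, where s = "\<lambda>i. Re (s i)"] \<eta>(2)) auto
      finally show "norm (of_nat M powr (1 - z) * mzpart r s M) \<le> C ^ r * real M powr (- \<eta>)"
        by (simp add: mult.commute)
    qed
    have "(\<lambda>M. real M powr (- \<eta>)) \<longlonglongrightarrow> 0"
      using \<eta>(1) by (intro tendsto_neg_powr filterlim_real_sequentially) auto
    then show "(\<lambda>M. C ^ r * real M powr (- \<eta>)) \<longlonglongrightarrow> 0"
      by (rule tendsto_mult_right_zero)
  qed
qed

section \<open>Truncated sums as sums over tuples, and their limit\<close>

definition bounded_tuples :: "nat \<Rightarrow> nat \<Rightarrow> (nat \<Rightarrow> nat) set" where
  "bounded_tuples r M = {m \<in> increasing_tuples r. \<forall>i\<in>{1..r}. m i \<le> M}"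

lemma finite_bounded_tuples: "finite (bounded_tuples r M)"
proof (rule finite_subset)
  show "bounded_tuples r M \<subseteq> {1..r} \<rightarrow>\<^sub>E {..M}"
    by (auto simp: bounded_tuples_def increasing_tuples_def PiE_def)
qed (auto intro: finite_PiE)

lemma bounded_tuples_0: "bounded_tuples 0 M = {\<lambda>_. undefined}"
  by (auto simp: bounded_tuples_def increasing_tuples_def strict_mono_on_def)

lemma increasing_tuples_Suc_restrict:
  assumes "t \<in> increasing_tuples (Suc r)"
  shows "t(Suc r := undefined) \<in> increasing_tuples r" "\<And>i. i \<in> {1..r} \<Longrightarrow> t i < t (Suc r)" "t (Suc r) > 0"
  using assms
  by (auto simp: increasing_tuples_def strict_mono_on_def PiE_def extensional_def Pi_def)

lemma increasing_tuples_extend: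
  assumes "t \<in> increasing_tuples r" "\<And>i. i \<in> {1..r} \<Longrightarrow> t i < m" "m > 0"
  shows "t(Suc r := m) \<in> increasing_tuples (Suc r)"
  using assms
  by (auto simp: increasing_tuples_def strict_mono_on_def PiE_def extensional_def Pi_def le_Suc_eq)

text \<open>Splitting off the largest entry matches the recursion of \<open>mzpart\<close>. The
  removed coordinate is reset to \<open>undefined\<close>, since tuples are extensional.\<close>

lemma mzpart_eq_sum_tuples:
  "mzpart r s M = (\<Sum>m\<in>bounded_tuples r M. \<Prod>i=1..r. of_nat (m i) powr (- s i))"
proof (induction r arbitrary: M)
  case 0
  then show ?case by (simp add: bounded_tuples_0)
next
  case (Suc r)
  have "mzpart (Suc r) s M = (\<Sum>m=1..M. \<Sum>t\<in>bounded_tuples r (m - 1).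
      of_nat m powr (- s (Suc r)) * (\<Prod>i=1..r. of_nat (t i) powr (- s i)))"
    by (simp add: Suc sum_distrib_left)
  also have "\<dots> = (\<Sum>(m, t)\<in>(SIGMA m:{1..M}. bounded_tuples r (m - 1)).
      of_nat m powr (- s (Suc r)) * (\<Prod>i=1..r. of_nat (t i) powr (- s i)))"
    by (subst sum.Sigma) (auto simp: finite_bounded_tuples)
  also have "\<dots> = (\<Sum>m\<in>bounded_tuples (Suc r) M. \<Prod>i=1..Suc r. of_nat (m i) powr (- s i))"
  proof (rule sum.reindex_bij_witness[of _ "\<lambda>t. (t (Suc r), t(Suc r := undefined))" "\<lambda>(m, t). t(Suc r := m)"])
    fix p assume p: "p \<in> (SIGMA m:{1..M}. bounded_tuples r (m - 1))"
    then obtain m t where mt: "p = (m, t)" "m \<in> {1..M}" "t \<in> bounded_tuples r (m - 1)" by auto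
    have lt: "t i < m" if "i \<in> {1..r}" for i
    proof -
      have "t i \<le> m - 1" using mt(3) that unfolding bounded_tuples_def by blast
      then show ?thesis using mt(2) by (simp, arith)
    qed
    have "t (Suc r) = undefined"
      using mt by (auto simp: bounded_tuples_def increasing_tuples_def PiE_def extensional_def)
    then show "((case p of (m, t) \<Rightarrow> t(Suc r := m)) (Suc r), (case p of (m, t) \<Rightarrow> t(Suc r := m))(Suc r := undefined)) = p"
      using mt by auto
    have "t(Suc r := m) \<in> increasing_tuples (Suc r)"
      by (rule increasing_tuples_extend) (use mt lt in \<open>auto simp: bounded_tuples_def\<close>)
    moreover have "(t(Suc r := m)) i \<le> M" if "i \<in> {1..Suc r}" for i
      using that lt[of i] mt(2) by (cases "i = Suc r") auto
    ultimately show "(case p of (m, t) \<Rightarrow> t(Suc r := m)) \<in> bounded_tuples (Suc r) M"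
      unfolding mt(1) bounded_tuples_def mem_Collect_eq prod.case by (intro conjI ballI)
    have "(\<Prod>i=1..r. of_nat ((t(Suc r := m)) i) powr (- s i)) = (\<Prod>i=1..r. of_nat (t i) powr (- s i))"
      by (rule prod.cong) auto
    then show "(\<Prod>i=1..Suc r. of_nat ((case p of (m, t) \<Rightarrow> t(Suc r := m)) i) powr (- s i)) =
        (case p of (m, t) \<Rightarrow> of_nat m powr (- s (Suc r)) * (\<Prod>i=1..r. of_nat (t i) powr (- s i)))"
      unfolding mt(1) prod.case by (simp add: mult.commute)
  next
    fix t assume t: "t \<in> bounded_tuples (Suc r) M"
    then have t': "t \<in> increasing_tuples (Suc r)" by (simp add: bounded_tuples_def)
    show "(case (t (Suc r), t(Suc r := undefined)) of (m, t) \<Rightarrow> t(Suc r := m)) = t" by simp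
    show "(t (Suc r), t(Suc r := undefined)) \<in> (SIGMA m:{1..M}. bounded_tuples r (m - 1))"
    proof -
      have "t (Suc r) \<le> M" using t by (simp add: bounded_tuples_def)
      moreover have "(t(Suc r := undefined)) i \<le> t (Suc r) - 1" if "i \<in> {1..r}" for i
        using that increasing_tuples_Suc_restrict(2)[OF t' that] by simp
      ultimately have "t(Suc r := undefined) \<in> bounded_tuples r (t (Suc r) - 1)" "t (Suc r) \<in> {1..M}"
        using increasing_tuples_Suc_restrict(1,3)[OF t'] by (simp_all add: bounded_tuples_def)
      then show ?thesis by (intro SigmaI)
    qed
  qed
  finally show ?case .
qed

text \<open>The uniform bound on sums of absolute values gives summability. The tuples bounded by
  \<open>M\<close> eventually contain any given finite set of tuples, so the truncations follow the
  filter that defines the infinite sum.\<close>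

lemma mzpart_tendsto_mzeta_series:
  assumes "s \<in> convergence_region r"
  shows "(\<lambda>M. mzpart r s M) \<longlonglongrightarrow> mzeta_series r s"
proof -
  define f where "f m = (\<Prod>i=1..r. of_nat (m i) powr (- s i))" for m :: "nat \<Rightarrow> nat"
  obtain \<eta> where \<eta>: "\<eta> > 0"
    "\<And>k. k \<in> {1..r} \<Longrightarrow> last_sum r k (\<lambda>i. Re (s i)) \<ge> real k * (1 + \<eta>)"
    using convergence_region_margin[OF assms] by blast
  obtain C where C: "\<And>M. (\<Sum>m=1..M. real m powr (- (1 + \<eta>))) \<le> C"
    using zeta_partial_bounded[OF \<eta>(1)] by blast
  have exhaust: "\<exists>N. \<forall>M\<ge>N. F \<subseteq> bounded_tuples r M" if F: "finite F" "F \<subseteq> increasing_tuples r" for F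
  proof -
    have "m \<in> bounded_tuples r M" if "m \<in> F" "M \<ge> (\<Sum>m\<in>F. \<Sum>i=1..r. m i)" for m M
    proof -
      have "m i \<le> M" if "i \<in> {1..r}" for i
      proof -
        have "m i \<le> (\<Sum>i=1..r. m i)" using that by (intro member_le_sum) auto
        also have "\<dots> \<le> (\<Sum>m\<in>F. \<Sum>i=1..r. m i)" using \<open>m \<in> F\<close> F by (intro member_le_sum) auto
        finally show ?thesis using \<open>M \<ge> _\<close> by simp
      qed
      then show ?thesis using that F by (auto simp: bounded_tuples_def)
    qed
    then show ?thesis by blast
  qed
  have "(\<Sum>m\<in>F. norm (f m)) \<le> C ^ r" if F: "finite F" "F \<subseteq> increasing_tuples r" for F
  proof -
    obtain M where M: "F \<subseteq> bounded_tuples r M" using exhaust[OF F] by blast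
    have "(\<Sum>m\<in>F. norm (f m)) \<le> (\<Sum>m\<in>bounded_tuples r M. norm (f m))"
      by (intro sum_mono2 finite_bounded_tuples M) auto
    also have "\<dots> = (\<Sum>m\<in>bounded_tuples r M. \<Prod>i=1..r. of_nat (m i) powr (- Re (s i)))"
      unfolding f_def prod_norm[symmetric]
      using norm_powr_real_powr[of "of_nat _" "- s _"] by (intro sum.cong prod.cong) auto
    also have "\<dots> = mzpart r (\<lambda>i. Re (s i)) M" by (rule mzpart_eq_sum_tuples[symmetric])
    also have "\<dots> \<le> C ^ r" by (rule mzpart_bounded(1)[OF \<eta>(1) C \<eta>(2)])
    finally show ?thesis .
  qed
  then have "bdd_above (sum (\<lambda>m. norm (f m)) ` {F. F \<subseteq> increasing_tuples r \<and> finite F})"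
    by (intro bdd_aboveI2[of _ _ "C ^ r"]) blast
  then have "(\<lambda>m. norm (f m)) summable_on increasing_tuples r"
    by (rule nonneg_bdd_above_summable_on[rotated]) simp
  then have "f summable_on increasing_tuples r" by (rule abs_summable_summable)
  then have "(f has_sum mzeta_series r s) (increasing_tuples r)"
    unfolding mzeta_series_def f_def by (rule has_sum_infsum)
  then have lim: "(sum f \<longlongrightarrow> mzeta_series r s) (finite_subsets_at_top (increasing_tuples r))"
    by (simp add: has_sum_def)
  have "filterlim (bounded_tuples r) (finite_subsets_at_top (increasing_tuples r)) sequentially"
    unfolding filterlim_iff eventually_finite_subsets_at_top
  proof (intro allI impI)
    fix P assume "\<exists>X. finite X \<and> X \<subseteq> increasing_tuples r \<and>
       (\<forall>Y. finite Y \<and> X \<subseteq> Y \<and> Y \<subseteq> increasing_tuples r \<longrightarrow> P Y)"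
    then obtain X where X: "finite X" "X \<subseteq> increasing_tuples r"
      and P: "\<forall>Y. finite Y \<and> X \<subseteq> Y \<and> Y \<subseteq> increasing_tuples r \<longrightarrow> P Y"
      by (elim exE conjE)
    obtain N where N: "\<forall>M\<ge>N. X \<subseteq> bounded_tuples r M" using exhaust[OF X] by (elim exE)
    have "P (bounded_tuples r M)" if "M \<ge> N" for M
      by (rule P[rule_format], intro conjI finite_bounded_tuples N[rule_format] that)
        (auto simp: bounded_tuples_def)
    then show "\<forall>\<^sub>F M in sequentially. P (bounded_tuples r M)"
      unfolding eventually_at_top_linorder by blast
  qed
  from filterlim_compose[OF lim this] show ?thesis
    unfolding mzpart_eq_sum_tuples f_def .
qed

section \<open>Merging adjacent entries\<close>

text \<open>On positive positions, \<open>i = 0\<close> merely deletes the first entry. By this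
  convention the identities below also cover a first entry, which has no left neighbour.\<close>

definition merge_entries :: "nat \<Rightarrow> 'a \<Rightarrow> (nat \<Rightarrow> 'a) \<Rightarrow> nat \<Rightarrow> 'a :: comm_ring_1" where
  "merge_entries i c s = (\<lambda>l. if l < i then s l else if l = i then s i + s (Suc i) + c else s (Suc l))"

lemma mzpart_at_0: "mzpart r s 0 = (if r = 0 then 1 else 0)"
  by (cases r) auto

text \<open>Raising the truncation adds the terms with largest variable \<open>M + 1\<close>, and
  there the merged exponent splits off exactly the factor \<open>(M + 1)^(1 - s - j)\<close>; the
  sum over \<open>j\<close> of these factors is \<open>em_term\<close>.\<close>

lemma mzpart_merge_Suc:
  fixes s :: "nat \<Rightarrow> complex"
  shows "(\<Sum>j\<le>J. em_coeff (s (Suc r)) j * mzpart r (merge_entries r (of_nat j - 1) s) (Suc M)) =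
     (\<Sum>j\<le>J. em_coeff (s (Suc r)) j * mzpart r (merge_entries r (of_nat j - 1) s) M)
     + em_term J (s (Suc r)) (Suc M) * (mzpart r s (Suc M) - mzpart r s M)"
proof (cases r)
  case 0
  then show ?thesis by simp
next
  case (Suc q)
  define x where "x = (of_nat (Suc M) :: complex)"
  have "mzpart r (merge_entries r (of_nat j - 1) s) (Suc M) = mzpart r (merge_entries r (of_nat j - 1) s) M
      + x powr (1 - s (Suc r) - of_nat j) * (x powr (- s r) * mzpart q s M)" for j
  proof -
    have "mzpart q (merge_entries r (of_nat j - 1) s) M = mzpart q s M"
      by (rule mzpart_cong) (auto simp: merge_entries_def Suc)
    moreover have "x powr (- merge_entries r (of_nat j - 1) s r) = x powr (1 - s (Suc r) - of_nat j) * x powr (- s r)"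
      unfolding powr_add[symmetric] by (simp add: merge_entries_def algebra_simps)
    ultimately show ?thesis unfolding Suc mzpart_Suc_Suc x_def by simp
  qed
  moreover have "mzpart r s (Suc M) - mzpart r s M = x powr (- s r) * mzpart q s M"
    unfolding Suc mzpart_Suc_Suc x_def by simp
  ultimately show ?thesis
    by (simp add: em_term_def x_def distrib_left sum.distrib sum_distrib_right mult.assoc del: of_nat_Suc)
qed

text \<open>Summation by parts: \<open>em_error\<close> writes \<open>(s - 1) m^(-s)\<close> as a
  difference of values of \<open>em_term\<close> plus a defect, and \<open>mzpart_merge_Suc\<close>
  collects the increments of the inner sum. The defects start at \<open>m = 2\<close>, since at
  \<open>m = 1\<close> the approximation would be taken at \<open>0\<close>; the term
  \<open>m = 1\<close> itself is nonzero only for \<open>r = 0\<close>.\<close>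

lemma mzpart_euler_maclaurin:
  fixes s :: "nat \<Rightarrow> complex"
  assumes "M \<ge> 1"
  shows "(s (Suc r) - 1) * mzpart (Suc r) s M = (if r = 0 then s (Suc r) - 1 else 0)
    + (\<Sum>j\<le>J. em_coeff (s (Suc r)) j * mzpart r (merge_entries r (of_nat j - 1) s) M)
    - em_term J (s (Suc r)) M * mzpart r s M
    + (\<Sum>m=2..M. em_error J (s (Suc r)) m * mzpart r s (m - 1))"
  using assms
proof (induction M rule: nat_induct_at_least)
  case base
  have "mzpart r t 1 = mzpart r s 1" for t
    by (cases r) (auto simp: mzpart_at_0)
  then have "(\<Sum>j\<le>J. em_coeff (s (Suc r)) j * mzpart r (merge_entries r (of_nat j - 1) s) 1) =
      (\<Sum>j\<le>J. em_coeff (s (Suc r)) j * mzpart r s 1)"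
    by (intro sum.cong refl arg_cong2[where f = times])
  also have "\<dots> = em_term J (s (Suc r)) 1 * mzpart r s 1"
    by (simp add: em_term_def sum_distrib_right)
  finally have "(\<Sum>j\<le>J. em_coeff (s (Suc r)) j * mzpart r (merge_entries r (of_nat j - 1) s) 1) =
      em_term J (s (Suc r)) 1 * mzpart r s 1" .
  then show ?case by (simp add: mzpart_at_0)
next
  case (Suc M)
  define z where "z = s (Suc r)"
  define A where "A M = (\<Sum>j\<le>J. em_coeff z j * mzpart r (merge_entries r (of_nat j - 1) s) M)" for M
  define S where "S M = (\<Sum>m=2..M. em_error J z m * mzpart r s (m - 1))" for M
  have 1: "A (Suc M) = A M + em_term J z (Suc M) * (mzpart r s (Suc M) - mzpart r s M)"
    unfolding A_def z_def by (rule mzpart_merge_Suc)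
  have 2: "S (Suc M) = S M + em_error J z (Suc M) * mzpart r s M"
    using Suc.hyps by (simp add: S_def)
  have 3: "em_error J z (Suc M) = (z - 1) * of_nat (Suc M) powr (- z) - em_term J z M + em_term J z (Suc M)"
    by (simp add: em_error_def del: of_nat_Suc)
  have 4: "mzpart (Suc r) s (Suc M) = mzpart (Suc r) s M + of_nat (Suc M) powr (- z) * mzpart r s M"
    unfolding mzpart_Suc_Suc z_def ..
  have IH: "(z - 1) * mzpart (Suc r) s M = (if r = 0 then z - 1 else 0) + A M - em_term J z M * mzpart r s M + S M"
    using Suc.IH by (simp add: z_def A_def S_def)
  have "(z - 1) * mzpart (Suc r) s (Suc M) = (z - 1) * mzpart (Suc r) s M + (z - 1) * of_nat (Suc M) powr (- z) * mzpart r s M"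
    unfolding 4 by (simp only: distrib_left mult.assoc)
  also have "\<dots> = (if r = 0 then z - 1 else 0) + A (Suc M) - em_term J z (Suc M) * mzpart r s (Suc M) + S (Suc M)"
    unfolding IH 1 2 3 by (simp only: ring_distribs) simp
  finally show ?case unfolding z_def A_def S_def .
qed

definition merge_point :: "nat \<Rightarrow> nat \<Rightarrow> complex \<Rightarrow> (nat \<Rightarrow> complex) \<Rightarrow> nat \<Rightarrow> complex" where
  "merge_point r i c s = restrict (merge_entries i c s) {1..r}"

lemma merge_point_in_space: "merge_point r i c s \<in> complex_space r"
  by (simp add: merge_point_def complex_space_def)

lemma mzpart_merge_point: "mzpart r (merge_point r i c s) M = mzpart r (merge_entries i c s) M"
  by (rule mzpart_cong) (simp add: merge_point_def)

text \<open>A window of last entries that reaches the merged position covers one more entry of the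
  original tuple and picks up the correction; a shorter window only shifts by one position.\<close>

lemma last_sum_merge:
  assumes "i \<le> r" "k \<in> {1..r}"
  shows "last_sum r k (merge_entries i c s) = (if k \<le> r - i then last_sum (Suc r) k s else last_sum (Suc r) (Suc k) s + c)"
proof (cases "k \<le> r - i")
  case True
  have "sum (merge_entries i c s) {r - k<..r} = sum s {Suc r - k<..Suc r}"
    by (rule sum.reindex_bij_witness[of _ "\<lambda>l. l - 1" Suc]) (use True assms in \<open>auto simp: merge_entries_def\<close>)
  then show ?thesis using True assms by (simp add: last_sum_eq)
next
  case False
  have e: "{r - k<..r} = {r - k<..<i} \<union> ({i} \<union> {i<..r})" "{r - k<..Suc r} = {r - k<..<i} \<union> ({i, Suc i} \<union> {Suc i<..Suc r})"
    using False assms by auto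
  have "sum (merge_entries i c s) {r - k<..<i} = sum s {r - k<..<i}"
    by (rule sum.cong) (auto simp: merge_entries_def)
  moreover have "sum (merge_entries i c s) {i<..r} = sum s {Suc i<..Suc r}"
    by (rule sum.reindex_bij_witness[of _ "\<lambda>l. l - 1" Suc]) (auto simp: merge_entries_def)
  moreover have "sum (merge_entries i c s) {r - k<..r} = sum (merge_entries i c s) {r - k<..<i} + (merge_entries i c s i + sum (merge_entries i c s) {i<..r})"
    unfolding e by (subst sum.union_disjoint; (subst sum.union_disjoint)?) auto
  moreover have "sum s {r - k<..Suc r} = sum s {r - k<..<i} + (s i + s (Suc i) + sum s {Suc i<..Suc r})"
    unfolding e by (subst sum.union_disjoint; (subst sum.union_disjoint)?) auto
  ultimately have "sum (merge_entries i c s) {r - k<..r} = sum s {r - k<..Suc r} + c"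
    by (simp add: merge_entries_def algebra_simps)
  then show ?thesis using False assms by (simp add: last_sum_eq)
qed

lemma last_sum_merge_point:
  assumes "i \<le> r" "k \<in> {1..r}"
  shows "last_sum r k (merge_point r i c s) = (if k \<le> r - i then last_sum (Suc r) k s else last_sum (Suc r) (Suc k) s + c)"
proof -
  have "last_sum r k (merge_point r i c s) = last_sum r k (merge_entries i c s)"
    unfolding last_sum_def merge_point_def using assms(2) by (intro sum.cong) auto
  then show ?thesis by (simp only: last_sum_merge[OF assms])
qed

text \<open>This is the source of the list of hyperplanes. For one variable the only value is
  \<open>1\<close>, which moves to \<open>2 - j\<close>; with odd \<open>j > 1\<close> excluded this
  gives \<open>2, 1, 0, -2, -4, ...\<close>. From two variables on, a value at most \<open>k\<close>
  moves to an integer at most \<open>k + 1\<close>.\<close>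

lemma singular_values_Suc:
  assumes "c \<in> singular_values k" "k \<ge> 1" "odd j \<Longrightarrow> j = 1"
  shows "c - (int j - 1) \<in> singular_values (Suc k)"
proof -
  consider "k = 1" | "k \<ge> 2" using assms(2) by linarith
  then show ?thesis
  proof cases
    case 1
    then have c: "c = 1" using assms by (simp add: singular_values_def)
    show ?thesis
    proof (cases "j \<le> 1")
      case True
      then have "j = 0 \<or> j = 1" by linarith
      then show ?thesis using 1 c by (auto simp: singular_values_def)
    next
      case False
      then have "even j" using assms(3) by auto
      then obtain h where h: "j = 2 * h" by blast
      then have "c - (int j - 1) = - 2 * int (h - 1)" using c False by (simp add: of_nat_diff)
      then show ?thesis using 1 by (auto simp: singular_values_def)
    qed
  next
    case 2
    have "c \<le> int k" using assms(1) 2 by (auto simp: singular_values_def split: if_splits)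
    then show ?thesis using 2 by (simp add: singular_values_def)
  qed
qed

lemma merge_point_regular:
  assumes s: "s \<in> regular_points (Suc r)" and i: "i \<le> r" and j: "odd j \<Longrightarrow> j = 1"
  shows "merge_point r i (of_nat j - 1) s \<in> regular_points r"
proof -
  have reg: "last_sum (Suc r) k s \<notin> of_int ` singular_values k" if "k \<in> {1..Suc r}" for k
    using s that unfolding regular_points_def by blast
  have "last_sum r k (merge_point r i (of_nat j - 1) s) \<notin> of_int ` singular_values k" if k: "k \<in> {1..r}" for k
  proof (cases "k \<le> r - i")
    case True
    then show ?thesis using reg[of k] k by (simp add: last_sum_merge_point[OF i k])
  next
    case False
    have "last_sum (Suc r) (Suc k) s + (of_nat j - 1) \<noteq> of_int c" if c: "c \<in> singular_values k" for c
    proof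
      assume "last_sum (Suc r) (Suc k) s + (of_nat j - 1) = of_int c"
      then have "last_sum (Suc r) (Suc k) s = of_int (c - (int j - 1))" by (simp add: algebra_simps)
      moreover have "c - (int j - 1) \<in> singular_values (Suc k)"
        by (rule singular_values_Suc) (use c k j in auto)
      ultimately show False using reg[of "Suc k"] k by (metis atLeastAtMost_iff image_eqI Suc_le_mono le_SucI)
    qed
    then show ?thesis using False by (auto simp: last_sum_merge_point[OF i k])
  qed
  then show ?thesis by (simp add: regular_points_def merge_point_in_space)
qed

text \<open>The correction lowers a window sum by at most one, which is exactly what the longer
  original window has in reserve.\<close>

lemma merge_point_convergence:
  assumes s: "s \<in> convergence_region (Suc r)" and i: "i \<le> r" and c: "Re c \<ge> -1"
  shows "merge_point r i c s \<in> convergence_region r"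
proof -
  have reg: "Re (last_sum (Suc r) k s) > real k" if "k \<in> {1..Suc r}" for k
    using s that unfolding convergence_region_def by blast
  have "Re (last_sum r k (merge_point r i c s)) > real k" if k: "k \<in> {1..r}" for k
    using reg[of k] reg[of "Suc k"] k c by (auto simp: last_sum_merge_point[OF i k])
  then show ?thesis by (simp add: convergence_region_def merge_point_in_space)
qed

section \<open>Coordinate boxes and uniform convergence of the error series\<close>

definition coord_box :: "nat \<Rightarrow> nat \<Rightarrow> (nat \<Rightarrow> complex) set" where
  "coord_box r B = {s. \<forall>i\<in>{1..r}. norm (s i) < real B}"

lemma open_coord_box: "open (coord_box r B)"
proof -
  have "coord_box r B = (\<Inter>i\<in>{1..r}. {s. norm (s i) < real B})"
    by (auto simp: coord_box_def)
  moreover have "open {s :: nat \<Rightarrow> complex. norm (s i) < real B}" for i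
    by (intro open_Collect_less continuous_on_norm continuous_on_product_coordinates continuous_on_const)
  ultimately show ?thesis by (simp add: open_INT)
qed

lemma coord_box_exhausts: "\<exists>B. s \<in> coord_box r B"
proof -
  obtain B :: nat where B: "(\<Sum>i=1..r. norm (s i)) < real B" using reals_Archimedean2 by blast
  have "norm (s i) < real B" if "i \<in> {1..r}" for i
    using member_le_sum[of i "{1..r}" "\<lambda>i. norm (s i)"] that B by simp
  then show ?thesis unfolding coord_box_def by blast
qed

lemma continuous_on_nat_powr:
  "continuous_on A f \<Longrightarrow> continuous_on A (\<lambda>x. of_nat m powr (f x :: complex))"
  unfolding powr_def by (cases "m = 0") (auto intro!: continuous_intros)

lemma holomorphic_on_nat_powr:
  "f holomorphic_on A \<Longrightarrow> (\<lambda>x. of_nat m powr (f x :: complex)) holomorphic_on A"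
  unfolding powr_def by (cases "m = 0") (auto intro!: holomorphic_intros)

lemma continuous_on_coord: "continuous_on A (\<lambda>s. s i :: complex)"
  by (rule continuous_on_product_coordinates[THEN continuous_on_subset]) simp

lemma holomorphic_on_upd: "(\<lambda>z. (s(i := z)) l) holomorphic_on A"
  by (cases "l = i") (auto intro!: holomorphic_intros)

lemma continuous_on_mzpart: "continuous_on A (\<lambda>s :: nat \<Rightarrow> complex. mzpart r s M)"
  by (induction r arbitrary: M)
    (auto intro!: continuous_intros continuous_on_nat_powr continuous_on_coord)

lemma holomorphic_on_mzpart: "(\<lambda>z. mzpart r (s(i := z)) M) holomorphic_on A"
proof (induction r arbitrary: M)
  case (Suc r)
  show ?case unfolding mzpart.simps
    by (intro holomorphic_on_sum holomorphic_on_mult Suc holomorphic_on_nat_powr holomorphic_on_minus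
        holomorphic_on_upd)
qed auto

lemma holomorphic_on_em_coeff: "(\<lambda>z. em_coeff z j) holomorphic_on A"
  unfolding em_coeff_def pochhammer_prod by (intro holomorphic_intros)

lemma holomorphic_on_em_error: "(\<lambda>z. em_error J z m) holomorphic_on A"
  unfolding em_error_def em_term_def
  by (intro holomorphic_intros holomorphic_on_em_coeff holomorphic_on_nat_powr)

definition em_series :: "nat \<Rightarrow> nat \<Rightarrow> (nat \<Rightarrow> complex) \<Rightarrow> complex" where
  "em_series r J s = (\<Sum>m. em_error J (s (Suc r)) (m + 2) * mzpart r s (m + 1))"

text \<open>On a box of size \<open>B\<close> the defect decays like \<open>m^(-(J + 1 - B))\<close>
  and the inner sum grows at most like \<open>m^(r (B + 1))\<close>; this order leaves a decay of at
  least \<open>m^(-2)\<close>. It also makes \<open>J + 1\<close> exceed \<open>k (B + 1)\<close>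
  for all \<open>k \<le> r + 1\<close>, as used in \<open>em_continuation_Suc\<close>.\<close>

definition em_order :: "nat \<Rightarrow> nat \<Rightarrow> nat" where
  "em_order r B = r * (B + 1) + B + 2"

lemma em_series_dominated:
  assumes J: "J \<ge> em_order r B"
  shows "\<exists>C. \<forall>s\<in>coord_box (Suc r) B. \<forall>m.
     norm (em_error J (s (Suc r)) (m + 2) * mzpart r s (m + 1)) \<le> C * (1 / real (m + 2) ^ 2)"
proof -
  define a where "a = r * (B + 1)"
  have "B \<le> J" using J by (simp add: em_order_def)
  then obtain C where C: "C \<ge> 0"
    "\<And>z m. norm z \<le> real B \<Longrightarrow> m \<ge> 2 \<Longrightarrow> norm (em_error J z m) \<le> C / real m ^ (J + 1 - B)"
    using em_error_bound by blast
  have "norm (em_error J (s (Suc r)) (m + 2) * mzpart r s (m + 1)) \<le> C * (1 / real (m + 2) ^ 2)"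
    if s: "s \<in> coord_box (Suc r) B" for s m
  proof -
    have x: "real (m + 2) \<ge> 1" by simp
    have 1: "norm (em_error J (s (Suc r)) (m + 2)) \<le> C / real (m + 2) ^ (J + 1 - B)"
      by (rule C(2)) (use s in \<open>auto simp: coord_box_def less_imp_le\<close>)
    have "norm (mzpart r s (m + 1)) \<le> real (m + 1) ^ a"
      unfolding a_def by (rule norm_mzpart_le_power) (use s in \<open>auto simp: coord_box_def less_imp_le\<close>)
    also have "\<dots> \<le> real (m + 2) ^ a" by (intro power_mono) auto
    finally have 2: "norm (mzpart r s (m + 1)) \<le> real (m + 2) ^ a" .
    have "norm (em_error J (s (Suc r)) (m + 2) * mzpart r s (m + 1)) \<le> C / real (m + 2) ^ (J + 1 - B) * real (m + 2) ^ a"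
      unfolding norm_mult by (intro mult_mono 1 2) (use C(1) in auto)
    also have "\<dots> \<le> C / real (m + 2) ^ (a + 2) * real (m + 2) ^ a"
      using J C(1) by (intro mult_right_mono divide_left_mono power_increasing x zero_le_power mult_pos_pos zero_less_power)
        (auto simp: em_order_def a_def)
    also have "\<dots> = C * (1 / real (m + 2) ^ 2)" by (simp add: power_add power2_eq_square del: of_nat_add)
    finally show ?thesis .
  qed
  then show ?thesis by blast
qed

lemma summable_inverse_square_shift: "summable (\<lambda>m. C * (1 / real (m + 2) ^ 2))"
proof -
  have "summable (\<lambda>m. inverse (real m ^ 2))" by (rule inverse_power_summable) simp
  then have "summable (\<lambda>m. inverse (real (m + 2) ^ 2))" by (subst summable_iff_shift)
  then show ?thesis by (intro summable_mult) (simp add: divide_inverse)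
qed

lemma em_series_uniform_limit:
  assumes "J \<ge> em_order r B"
  shows "uniform_limit (coord_box (Suc r) B)
    (\<lambda>n s. \<Sum>m<n. em_error J (s (Suc r)) (m + 2) * mzpart r s (m + 1)) (em_series r J) sequentially"
proof -
  obtain C where C: "\<And>s m. s \<in> coord_box (Suc r) B \<Longrightarrow>
      norm (em_error J (s (Suc r)) (m + 2) * mzpart r s (m + 1)) \<le> C * (1 / real (m + 2) ^ 2)"
    using em_series_dominated[OF assms] by metis
  show ?thesis
    unfolding em_series_def[abs_def]
    by (rule Weierstrass_m_test[OF C summable_inverse_square_shift])
qed

lemma em_series_tendsto:
  assumes "s \<in> coord_box (Suc r) B" "J \<ge> em_order r B"
  shows "(\<lambda>M. \<Sum>m=2..M. em_error J (s (Suc r)) m * mzpart r s (m - 1)) \<longlonglongrightarrow> em_series r J s"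
proof -
  have "(\<lambda>n. \<Sum>m<n. em_error J (s (Suc r)) (m + 2) * mzpart r s (m + 1)) \<longlonglongrightarrow> em_series r J s"
    by (rule tendsto_uniform_limitI[OF em_series_uniform_limit[OF assms(2)] assms(1)])
  moreover have "(\<Sum>m<n. em_error J (s (Suc r)) (m + 2) * mzpart r s (m + 1)) =
      (\<Sum>m=2..Suc n. em_error J (s (Suc r)) m * mzpart r s (m - 1))" for n
    by (rule sum.reindex_bij_witness[of _ "\<lambda>m. m - 2" "\<lambda>m. m + 2"]) auto
  ultimately have "(\<lambda>n. \<Sum>m=2..Suc n. em_error J (s (Suc r)) m * mzpart r s (m - 1)) \<longlonglongrightarrow> em_series r J s"
    by simp
  then show ?thesis by (rule LIMSEQ_imp_Suc)
qed

lemma continuous_on_em_series: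
  assumes "J \<ge> em_order r B"
  shows "continuous_on (coord_box (Suc r) B) (em_series r J)"
proof (rule uniform_limit_theorem[OF _ em_series_uniform_limit[OF assms]])
  have "continuous_on A (\<lambda>s. em_error J (s (Suc r)) m)" for A m
    by (rule continuous_on_compose2[OF holomorphic_on_imp_continuous_on[OF holomorphic_on_em_error[where A = UNIV]]
      continuous_on_coord]) simp
  then show "\<forall>\<^sub>F n in sequentially. continuous_on (coord_box (Suc r) B)
      (\<lambda>s. \<Sum>m<n. em_error J (s (Suc r)) (m + 2) * mzpart r s (m + 1))"
    by (intro always_eventually allI continuous_on_sum continuous_on_mult continuous_on_mzpart)
qed simp

lemma open_coord_box_slice: "open {z. s(i := z) \<in> coord_box r B}"
proof -
  have "{z. s(i := z) \<in> coord_box r B} = (\<Inter>l\<in>{1..r}. {z. norm ((s(i := z)) l) < real B})"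
    by (auto simp: coord_box_def)
  moreover have "open {z. norm ((s(i := z)) l) < real B}" for l
    by (intro open_Collect_less continuous_on_norm continuous_on_const
        holomorphic_on_imp_continuous_on holomorphic_on_upd)
  ultimately show ?thesis by (simp add: open_INT)
qed

lemma holomorphic_on_em_series:
  assumes "J \<ge> em_order r B"
  shows "(\<lambda>z. em_series r J (s(i := z))) holomorphic_on {z. s(i := z) \<in> coord_box (Suc r) B}"
    (is "_ holomorphic_on ?S")
proof (rule holomorphic_uniform_sequence[OF open_coord_box_slice])
  show "(\<lambda>z. \<Sum>m<n. em_error J ((s(i := z)) (Suc r)) (m + 2) * mzpart r (s(i := z)) (m + 1)) holomorphic_on ?S" for n
    by (intro holomorphic_on_sum holomorphic_on_mult holomorphic_on_mzpart
        holomorphic_on_compose[OF holomorphic_on_upd holomorphic_on_em_error, unfolded o_def])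
  fix x assume x: "x \<in> ?S"
  then obtain d where d: "d > 0" "cball x d \<subseteq> ?S"
    using open_coord_box_slice open_contains_cball by metis
  have "uniform_limit (cball x d)
     (\<lambda>n z. \<Sum>m<n. em_error J ((s(i := z)) (Suc r)) (m + 2) * mzpart r (s(i := z)) (m + 1))
     (\<lambda>z. em_series r J (s(i := z))) sequentially"
    by (rule uniform_limit_compose'[OF em_series_uniform_limit[OF assms]]) (use d in blast)
  then show "\<exists>d>0. cball x d \<subseteq> ?S \<and> uniform_limit (cball x d)
     (\<lambda>n z. \<Sum>m<n. em_error J ((s(i := z)) (Suc r)) (m + 2) * mzpart r (s(i := z)) (m + 1))
     (\<lambda>z. em_series r J (s(i := z))) sequentially"
    using d by blast
qed

section \<open>Analytic continuation\<close>

text \<open>Each coordinate enters at most one coordinate of the merged point, and there by a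
  translation. This is what carries separate holomorphy through a merge.\<close>

lemma merge_point_upd:
  assumes "i \<in> {1..Suc r}" "t \<le> r"
  shows "(\<forall>z. merge_point r t c (s(i := z)) = merge_point r t c s) \<or>
    (\<exists>l\<in>{1..r}. \<exists>a. \<forall>z. merge_point r t c (s(i := z)) = (merge_point r t c s)(l := z + a))"
proof (cases "r = 0 \<or> t = 0 \<and> i = 1")
  case True
  then have "merge_point r t c (s(i := z)) = merge_point r t c s" for z
    by (auto simp: merge_point_def merge_entries_def restrict_def)
  then show ?thesis by blast
next
  case False
  define l where "l = (if i \<le> t then i else i - 1)"
  define a where "a = (if i = t then s (Suc t) + c else if i = Suc t then s t + c else 0)"
  have "l \<in> {1..r}" using False assms by (auto simp: l_def)
  moreover have "merge_point r t c (s(i := z)) = (merge_point r t c s)(l := z + a)" for z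
    using False assms
    by (auto simp: merge_point_def merge_entries_def restrict_def l_def a_def fun_eq_iff)
  ultimately show ?thesis by blast
qed

lemma continuous_on_merge_point: "continuous_on A (merge_point r t c)"
proof -
  have "continuous_on A (\<lambda>s. merge_point r t c s l)" for l
    unfolding merge_point_def merge_entries_def restrict_def
    by (cases "l \<in> {1..r}"; cases l t rule: linorder_cases)
      (auto intro!: continuous_on_add continuous_on_const continuous_on_coord)
  then show ?thesis by (rule continuous_on_coordinatewise_then_product)
qed

lemma holomorphic_on_merge_point:
  assumes F: "holomorphic_several r F U" and i: "i \<in> {1..Suc r}" and t: "t \<le> r"
    and U: "\<And>z. z \<in> A \<Longrightarrow> merge_point r t c (s(i := z)) \<in> U"
  shows "(\<lambda>z. F (merge_point r t c (s(i := z)))) holomorphic_on A"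
proof (cases "\<forall>z. merge_point r t c (s(i := z)) = merge_point r t c s")
  case True
  then show ?thesis by simp
next
  case False
  then obtain l a where l: "l \<in> {1..r}"
    and eq: "\<And>z. merge_point r t c (s(i := z)) = (merge_point r t c s)(l := z + a)"
    using merge_point_upd[OF i t] by metis
  show ?thesis
  proof (cases "A = {}")
    case False
    \<comment> \<open>\<open>holomorphic_several\<close> provides slices through points of
      \<open>U\<close> only, and the merged point of \<open>s\<close> itself may lie outside
      \<open>U\<close>. The slice through the point that belongs to \<open>z0\<close> is the same
      line.\<close>
    then obtain z0 where "z0 \<in> A" by blast
    then have p: "(merge_point r t c s)(l := z0 + a) \<in> U" (is "?p \<in> U") using U eq by metis
    have "(\<lambda>w. F (?p(l := w))) holomorphic_on {w. ?p(l := w) \<in> U}"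
      using F p l unfolding holomorphic_several_def by blast
    then have "(\<lambda>w. F ((merge_point r t c s)(l := w))) holomorphic_on {w. (merge_point r t c s)(l := w) \<in> U}"
      by simp
    then have "((\<lambda>w. F ((merge_point r t c s)(l := w))) \<circ> (\<lambda>z. z + a)) holomorphic_on A"
      by (rule holomorphic_on_compose_gen[rotated])
        (use U eq in \<open>auto intro!: holomorphic_intros\<close>)
    then show ?thesis by (simp add: o_def eq)
  qed (simp add: holomorphic_on_def)
qed

lemma open_regular_slice:
  assumes "i \<in> {1..r}"
  shows "open {z. s(i := z) \<in> regular_points r}"
proof (cases "s(i := 0) \<in> complex_space r")
  case True
  then have sp: "s(i := z) \<in> complex_space r" for z
    using assms by (auto simp: complex_space_def PiE_def extensional_def)
  have "{z. s(i := z) \<in> regular_points r} =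
      (\<Inter>k\<in>{1..r}. (\<lambda>z. last_sum r k (s(i := z))) -` (- of_int ` singular_values k))"
    using sp by (auto simp: regular_points_def)
  moreover have "open ((\<lambda>z. last_sum r k (s(i := z))) -` (- of_int ` singular_values k))" for k
  proof (rule open_vimage)
    show "open (- of_int ` singular_values k :: complex set)"
      by (simp add: closed_of_int_image open_Compl)
    show "continuous_on UNIV (\<lambda>z. last_sum r k (s(i := z)))"
      unfolding last_sum_def
      by (intro continuous_on_sum holomorphic_on_imp_continuous_on holomorphic_on_upd)
  qed
  ultimately show ?thesis by (simp add: open_INT)
next
  case False
  then have "s(i := z) \<notin> complex_space r" for z
    using assms by (auto simp: complex_space_def PiE_def extensional_def)
  then show ?thesis by (simp add: regular_points_def)
qed

text \<open>Continuity and holomorphy are local, and the boxes are open and exhaust the space, so a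
  different representative \<open>F' B\<close> may be used on each box.\<close>

lemma holomorphic_several_box_cover:
  assumes hol: "\<And>B. holomorphic_several r (F' B) (regular_points r \<inter> coord_box r B)"
    and eq: "\<And>B s. s \<in> regular_points r \<Longrightarrow> s \<in> coord_box r B \<Longrightarrow> F s = F' B s"
  shows "holomorphic_several r F (regular_points r)"
  unfolding holomorphic_several_def
proof (intro conjI ballI)
  show "continuous_on (regular_points r) F"
    unfolding continuous_on_eq_continuous_within
  proof
    fix s assume s: "s \<in> regular_points r"
    obtain B where B: "s \<in> coord_box r B" using coord_box_exhausts by blast
    have "continuous_on (regular_points r \<inter> coord_box r B) (F' B)"
      using hol by (simp add: holomorphic_several_def)
    then have "continuous_on (regular_points r \<inter> coord_box r B) F"
      by (rule continuous_on_eq) (metis IntE eq)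
    then have "continuous (at s within regular_points r \<inter> coord_box r B) F"
      using s B by (simp add: continuous_on_eq_continuous_within)
    \<comment> \<open>The box is open in the whole function space: it constrains finitely many
      coordinates and is not cut down to \<open>complex_space\<close>.\<close>
    moreover have "at s within regular_points r \<inter> coord_box r B = at s within regular_points r"
      by (rule at_within_nhd[OF B open_coord_box]) auto
    ultimately show "continuous (at s within regular_points r) F" by simp
  qed
next
  fix s i assume s: "s \<in> regular_points r" and i: "i \<in> {1..r}"
  define S where "S B = {z. s(i := z) \<in> regular_points r \<inter> coord_box r B}" for B
  have "S B = {z. s(i := z) \<in> regular_points r} \<inter> {z. s(i := z) \<in> coord_box r B}" for B
    by (auto simp: S_def)
  then have S: "open (S B)" for B
    using open_regular_slice[OF i] open_coord_box_slice by (simp add: open_Int)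
  have "(\<lambda>z. F (s(i := z))) holomorphic_on S B" for B
  proof (cases "S B = {}")
    case False
    then obtain z0 where z0: "s(i := z0) \<in> regular_points r \<inter> coord_box r B" by (auto simp: S_def)
    have "(\<lambda>z. F' B ((s(i := z0))(i := z))) holomorphic_on {z. (s(i := z0))(i := z) \<in> regular_points r \<inter> coord_box r B}"
      using hol[of B] z0 i unfolding holomorphic_several_def by blast
    then have "(\<lambda>z. F' B (s(i := z))) holomorphic_on S B" by (simp add: S_def)
    then show ?thesis by (rule holomorphic_transform) (use eq in \<open>auto simp: S_def\<close>)
  qed (simp add: holomorphic_on_def)
  then have "(\<lambda>z. F (s(i := z))) holomorphic_on (\<Union>B. S B)"
    by (intro holomorphic_on_UN_open S)
  moreover have "(\<Union>B. S B) = {z. s(i := z) \<in> regular_points r}"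
    using coord_box_exhausts by (auto simp: S_def)
  ultimately show "(\<lambda>z. F (s(i := z))) holomorphic_on {z. s(i := z) \<in> regular_points r}" by simp
qed

text \<open>The identity \<open>mzpart_euler_maclaurin\<close> solved for the depth
  \<open>r + 1\<close> sum, with \<open>M\<close> sent to infinity and the boundary term
  gone.\<close>

definition em_continuation :: "nat \<Rightarrow> ((nat \<Rightarrow> complex) \<Rightarrow> complex) \<Rightarrow> nat \<Rightarrow> (nat \<Rightarrow> complex) \<Rightarrow> complex" where
  "em_continuation r F J s =
     ((if r = 0 then s (Suc r) - 1 else 0)
       + (\<Sum>j\<le>J. em_coeff (s (Suc r)) j * F (merge_point r r (of_nat j - 1) s))
       + em_series r J s) / (s (Suc r) - 1)"

lemma em_coeff_odd: "odd j \<Longrightarrow> j \<noteq> 1 \<Longrightarrow> em_coeff z j = 0"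
  by (simp add: em_coeff_def bern_coeff_odd)

lemma regular_last_neq_1: "s \<in> regular_points (Suc r) \<Longrightarrow> s (Suc r) \<noteq> 1"
  using last_sum_1[of "Suc r" s] unfolding regular_points_def
  by (force simp: singular_values_def)

lemma holomorphic_several_em_continuation:
  assumes F: "mzeta_continuation r F" and J: "J \<ge> em_order r B"
  shows "holomorphic_several (Suc r) (em_continuation r F J) (regular_points (Suc r) \<inter> coord_box (Suc r) B)"
    (is "holomorphic_several _ _ ?U")
proof -
  have FF: "holomorphic_several r F (regular_points r)" using F by (simp add: mzeta_continuation_def)
  then have contF: "continuous_on (regular_points r) F" by (simp add: holomorphic_several_def)
  have c1: "continuous_on ?U (\<lambda>s. em_coeff (s (Suc r)) j)" for j
    by (rule continuous_on_compose2[OF holomorphic_on_imp_continuous_on[OF holomorphic_on_em_coeff[where A = UNIV]]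
      continuous_on_coord]) simp
  have c2: "continuous_on ?U (\<lambda>s. em_coeff (s (Suc r)) j * F (merge_point r r (of_nat j - 1) s))" for j
  \<comment> \<open>For odd \<open>j > 1\<close> the merged point may be singular, where
    \<open>F\<close> is arbitrary; the zero coefficient alone makes the term continuous.\<close>
  proof (cases "odd j \<and> j \<noteq> 1")
    case False
    then have "merge_point r r (of_nat j - 1) s \<in> regular_points r" if "s \<in> ?U" for s
      using that by (intro merge_point_regular) auto
    then have "continuous_on ?U (\<lambda>s. F (merge_point r r (of_nat j - 1) s))"
      by (intro continuous_on_compose2[OF contF continuous_on_merge_point]) auto
    then show ?thesis by (intro continuous_on_mult c1)
  qed (simp add: em_coeff_odd)
  have c3: "continuous_on ?U (\<lambda>s. if r = 0 then s (Suc r) - 1 else 0)"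
    by (cases "r = 0") (auto intro!: continuous_on_diff continuous_on_coord continuous_on_const)
  have "continuous_on ?U (em_continuation r F J)"
    unfolding em_continuation_def[abs_def]
    by (intro continuous_on_divide continuous_on_add continuous_on_sum c2 c3 continuous_on_diff
        continuous_on_coord continuous_on_const continuous_on_subset[OF continuous_on_em_series[OF J]])
      (use regular_last_neq_1 in auto)
  moreover have "(\<lambda>z. em_continuation r F J (s(i := z))) holomorphic_on {z. s(i := z) \<in> ?U}" (is "_ holomorphic_on ?S")
    if i: "i \<in> {1..Suc r}" for s i
  proof -
    have h1: "(\<lambda>z. em_coeff ((s(i := z)) (Suc r)) j * F (merge_point r r (of_nat j - 1) (s(i := z)))) holomorphic_on ?S" for j
    proof (cases "odd j \<and> j \<noteq> 1")
      case False
      have "(\<lambda>z. F (merge_point r r (of_nat j - 1) (s(i := z)))) holomorphic_on ?S"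
        by (rule holomorphic_on_merge_point[OF FF i order_refl], rule merge_point_regular) (use False in auto)
      then show ?thesis
        by (intro holomorphic_on_mult holomorphic_on_compose[OF holomorphic_on_upd holomorphic_on_em_coeff, unfolded o_def])
    qed (simp add: em_coeff_odd)
    have h2: "(\<lambda>z. em_series r J (s(i := z))) holomorphic_on ?S"
      by (rule holomorphic_on_subset[OF holomorphic_on_em_series[OF J]]) auto
    have h3: "(\<lambda>z. if r = 0 then (s(i := z)) (Suc r) - 1 else 0) holomorphic_on ?S"
      by (cases "r = 0") (auto intro!: holomorphic_on_diff holomorphic_on_const holomorphic_on_upd simp del: fun_upd_apply)
    have ne: "(s(i := z)) (Suc r) - 1 \<noteq> 0" if "z \<in> ?S" for z
      using that regular_last_neq_1[of "s(i := z)" r] by auto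
    show ?thesis
      unfolding em_continuation_def[abs_def]
      by (intro holomorphic_on_divide holomorphic_on_add holomorphic_on_sum holomorphic_on_diff
        holomorphic_on_const holomorphic_on_upd h1 h2 h3 ne)
  qed
  ultimately show ?thesis by (simp add: holomorphic_several_def)
qed

lemma norm_last_sum_le:
  assumes "s \<in> coord_box r B" "k \<le> r"
  shows "norm (last_sum r k s) \<le> real k * real B"
proof -
  have "norm (last_sum r k s) \<le> (\<Sum>i=1..k. real B)"
    unfolding last_sum_def using assms
    by (intro sum_norm_le) (auto simp: coord_box_def intro!: less_imp_le)
  then show ?thesis by simp
qed

lemma convergence_region_in_regular: "convergence_region r \<subseteq> regular_points r"
proof
  fix s assume s: "s \<in> convergence_region r"
  have "last_sum r k s \<notin> of_int ` singular_values k" if k: "k \<in> {1..r}" for k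
  proof
    assume "last_sum r k s \<in> of_int ` singular_values k"
    then obtain c where c: "c \<in> singular_values k" "last_sum r k s = of_int c" by auto
    have "c \<le> int k" using c(1) by (auto simp: singular_values_def split: if_splits)
    moreover have "Re (last_sum r k s) > real k" using s k by (simp add: convergence_region_def)
    then have "of_int c > real k" by (simp add: c(2))
    ultimately show False by linarith
  qed
  then show "s \<in> regular_points r" using s by (simp add: regular_points_def convergence_region_def)
qed

lemma em_continuation_eq_series:
  assumes F: "mzeta_continuation r F" and J: "J \<ge> em_order r B"
    and s: "s \<in> coord_box (Suc r) B" "s \<in> convergence_region (Suc r)"
  shows "em_continuation r F J s = mzeta_series (Suc r) s"
proof -
  define z where "z = s (Suc r)"
  have z1: "z \<noteq> 1" using s(2) convergence_region_in_regular regular_last_neq_1 by (auto simp: z_def)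
  have A: "(\<lambda>M. \<Sum>j\<le>J. em_coeff z j * mzpart r (merge_entries r (of_nat j - 1) s) M)
      \<longlonglongrightarrow> (\<Sum>j\<le>J. em_coeff z j * F (merge_point r r (of_nat j - 1) s))"
  proof (intro tendsto_sum tendsto_mult tendsto_const)
    fix j :: nat
    have m: "merge_point r r (of_nat j - 1) s \<in> convergence_region r"
      by (rule merge_point_convergence[OF s(2)]) auto
    then have "F (merge_point r r (of_nat j - 1) s) = mzeta_series r (merge_point r r (of_nat j - 1) s)"
      using F by (simp add: mzeta_continuation_def)
    then show "(\<lambda>M. mzpart r (merge_entries r (of_nat j - 1) s) M) \<longlonglongrightarrow> F (merge_point r r (of_nat j - 1) s)"
      using mzpart_tendsto_mzeta_series[OF m] by (simp add: mzpart_merge_point)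
  qed
  have "(\<lambda>M. \<Sum>j\<le>J. em_coeff z j * (of_nat M powr (1 - (z + of_nat j)) * mzpart r s M)) \<longlonglongrightarrow> (\<Sum>j\<le>J. em_coeff z j * 0)"
    by (intro tendsto_sum tendsto_mult tendsto_const mzpart_boundary_tendsto_0[OF s(2)]) (simp add: z_def)
  then have Bd: "(\<lambda>M. em_term J z M * mzpart r s M) \<longlonglongrightarrow> 0"
    by (simp add: em_term_def sum_distrib_right mult.assoc diff_diff_eq)
  have S: "(\<lambda>M. \<Sum>m=2..M. em_error J z m * mzpart r s (m - 1)) \<longlonglongrightarrow> em_series r J s"
    unfolding z_def by (rule em_series_tendsto[OF s(1) J])
  have "(\<lambda>M. (if r = 0 then z - 1 else 0) + (\<Sum>j\<le>J. em_coeff z j * mzpart r (merge_entries r (of_nat j - 1) s) M)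
     - em_term J z M * mzpart r s M + (\<Sum>m=2..M. em_error J z m * mzpart r s (m - 1)))
     \<longlonglongrightarrow> (if r = 0 then z - 1 else 0) + (\<Sum>j\<le>J. em_coeff z j * F (merge_point r r (of_nat j - 1) s)) - 0 + em_series r J s"
    by (intro tendsto_add tendsto_diff tendsto_const A Bd S)
  moreover have "\<forall>\<^sub>F M in sequentially. (if r = 0 then z - 1 else 0) + (\<Sum>j\<le>J. em_coeff z j * mzpart r (merge_entries r (of_nat j - 1) s) M)
     - em_term J z M * mzpart r s M + (\<Sum>m=2..M. em_error J z m * mzpart r s (m - 1)) = (z - 1) * mzpart (Suc r) s M"
    by (rule eventually_mono[OF eventually_ge_at_top[of 1]]) (simp add: mzpart_euler_maclaurin[where J = J] z_def del: mzpart.simps)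
  ultimately have "(\<lambda>M. (z - 1) * mzpart (Suc r) s M) \<longlonglongrightarrow>
     (if r = 0 then z - 1 else 0) + (\<Sum>j\<le>J. em_coeff z j * F (merge_point r r (of_nat j - 1) s)) - 0 + em_series r J s"
    by (rule Lim_transform_eventually)
  moreover have "(\<lambda>M. (z - 1) * mzpart (Suc r) s M) \<longlonglongrightarrow> (z - 1) * mzeta_series (Suc r) s"
    by (intro tendsto_mult tendsto_const mzpart_tendsto_mzeta_series s(2))
  ultimately have "(if r = 0 then z - 1 else 0) + (\<Sum>j\<le>J. em_coeff z j * F (merge_point r r (of_nat j - 1) s)) - 0 + em_series r J s
     = (z - 1) * mzeta_series (Suc r) s"
    by (rule LIMSEQ_unique)
  then show ?thesis
    using z1 unfolding em_continuation_def z_def[symmetric] by (simp only: diff_zero) simp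
qed

text \<open>The truncated identities of orders \<open>J\<close> and \<open>J + 1\<close> at the same
  \<open>M\<close> are subtracted, which removes everything that may diverge. What is left converges
  term by term, since adding \<open>J + 1\<close> to the last coordinate carries every point of the
  box into the region of convergence.\<close>

lemma em_continuation_Suc:
  assumes F: "mzeta_continuation r F" and J: "J \<ge> em_order r B"
    and s: "s \<in> coord_box (Suc r) B" "s \<in> complex_space (Suc r)"
  shows "em_continuation r F (Suc J) s = em_continuation r F J s"
proof -
  define z where "z = s (Suc r)"
  \<comment> \<open>The merged point of order \<open>J + 1\<close> at \<open>s\<close> is the one
    with correction \<open>-1\<close> at \<open>s'\<close>, and \<open>mzpart r\<close> does not see
    coordinate \<open>Suc r\<close>. Convergence at \<open>s'\<close> thus controls both the new
    merged term and the new boundary term.\<close>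
  define s' where "s' = s(Suc r := z + of_nat (Suc J))"
  define E where "E J M = (\<Sum>m=2..M. em_error J z m * mzpart r s (m - 1))" for J M
  have s': "s' \<in> convergence_region (Suc r)"
  proof -
    have "Re (last_sum (Suc r) k s') > real k" if k: "k \<in> {1..Suc r}" for k
    proof -
      have "last_sum (Suc r) k s' = of_nat (Suc J) + last_sum (Suc r) k s"
        using last_sum_upd[OF k, of s z] last_sum_upd[OF k, of s "z + of_nat (Suc J)"]
        by (simp add: s'_def z_def)
      moreover have "- Re (last_sum (Suc r) k s) \<le> real k * real B"
        using norm_last_sum_le[OF s(1), of k] k abs_Re_le_cmod[of "last_sum (Suc r) k s"] by auto
      moreover have "k * (B + 1) \<le> Suc r * (B + 1)" using k by (intro mult_right_mono) auto
      then have "k * B + k < Suc J" using J by (simp add: em_order_def)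
      then have "real k * real B + real k < real (Suc J)" by (metis of_nat_add of_nat_less_iff of_nat_mult)
      ultimately show ?thesis by simp
    qed
    moreover have "s' \<in> complex_space (Suc r)"
      using s(2) by (auto simp: s'_def complex_space_def PiE_def extensional_def)
    ultimately show ?thesis by (simp add: convergence_region_def)
  qed
  have p: "merge_point r r (of_nat (Suc J) - 1) s = merge_point r r (-1) s'"
    by (auto simp: merge_point_def merge_entries_def s'_def z_def restrict_def fun_eq_iff)
  have mc: "merge_point r r (of_nat (Suc J) - 1) s \<in> convergence_region r"
    unfolding p by (rule merge_point_convergence[OF s']) auto
  have Fm: "F (merge_point r r (of_nat (Suc J) - 1) s) = mzeta_series r (merge_point r r (of_nat (Suc J) - 1) s)"
    using F mc by (simp add: mzeta_continuation_def)
  have A: "(\<lambda>M. mzpart r (merge_entries r (of_nat (Suc J) - 1) s) M) \<longlonglongrightarrow> F (merge_point r r (of_nat (Suc J) - 1) s)"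
    unfolding Fm mzpart_merge_point[symmetric] by (rule mzpart_tendsto_mzeta_series[OF mc])
  have "(\<lambda>M. of_nat M powr (1 - (z + of_nat (Suc J))) * mzpart r s' M) \<longlonglongrightarrow> 0"
    by (rule mzpart_boundary_tendsto_0[OF s']) (simp add: s'_def)
  moreover have "mzpart r s' M = mzpart r s M" for M
    by (rule mzpart_cong) (auto simp: s'_def)
  ultimately have Bd: "(\<lambda>M. of_nat M powr (1 - (z + of_nat (Suc J))) * mzpart r s M) \<longlonglongrightarrow> 0" by simp
  have S: "E (Suc J) \<longlonglongrightarrow> em_series r (Suc J) s" "E J \<longlonglongrightarrow> em_series r J s"
    unfolding z_def E_def[abs_def] using em_series_tendsto[OF s(1)] J by auto
  have id: "em_coeff z (Suc J) * mzpart r (merge_entries r (of_nat (Suc J) - 1) s) M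
      - em_coeff z (Suc J) * (of_nat M powr (1 - (z + of_nat (Suc J))) * mzpart r s M) + E (Suc J) M - E J M = 0"
    if "M \<ge> 1" for M
  proof -
    have e: "em_term (Suc J) z M = em_term J z M + em_coeff z (Suc J) * of_nat M powr (1 - (z + of_nat (Suc J)))"
      by (simp add: em_term_def diff_diff_eq)
    have cancel: "c * p - c * (w * m) + E' - E = 0"
      if "a = x + A - T * m + E" "a = x + (A + c * p) - (T + c * w) * m + E'"
      for a x A T m E E' c p w :: complex
      using that by (simp add: algebra_simps)
    have id: "(z - 1) * mzpart (Suc r) s M = (if r = 0 then z - 1 else 0)
        + (\<Sum>j\<le>K. em_coeff z j * mzpart r (merge_entries r (of_nat j - 1) s) M)
        - em_term K z M * mzpart r s M + E K M" for K
      unfolding z_def E_def by (rule mzpart_euler_maclaurin[OF that])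
    show ?thesis
      by (rule cancel[OF id[of J] id[of "Suc J", unfolded e sum.atMost_Suc]])
  qed
  have "(\<lambda>M. em_coeff z (Suc J) * mzpart r (merge_entries r (of_nat (Suc J) - 1) s) M
      - em_coeff z (Suc J) * (of_nat M powr (1 - (z + of_nat (Suc J))) * mzpart r s M) + E (Suc J) M - E J M)
      \<longlonglongrightarrow> em_coeff z (Suc J) * F (merge_point r r (of_nat (Suc J) - 1) s) - em_coeff z (Suc J) * 0
         + em_series r (Suc J) s - em_series r J s"
    by (intro tendsto_add tendsto_diff tendsto_mult tendsto_const A Bd S)
  moreover have "\<forall>\<^sub>F M in sequentially. em_coeff z (Suc J) * mzpart r (merge_entries r (of_nat (Suc J) - 1) s) M
      - em_coeff z (Suc J) * (of_nat M powr (1 - (z + of_nat (Suc J))) * mzpart r s M) + E (Suc J) M - E J M = 0"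
    by (rule eventually_mono[OF eventually_ge_at_top[of 1]]) (rule id)
  ultimately have "(\<lambda>M. 0) \<longlonglongrightarrow> em_coeff z (Suc J) * F (merge_point r r (of_nat (Suc J) - 1) s) - em_coeff z (Suc J) * 0
         + em_series r (Suc J) s - em_series r J s"
    by (rule Lim_transform_eventually)
  then have "em_coeff z (Suc J) * F (merge_point r r (of_nat (Suc J) - 1) s) + em_series r (Suc J) s = em_series r J s"
    using LIMSEQ_unique[OF tendsto_const] by fastforce
  then show ?thesis
    unfolding em_continuation_def z_def[symmetric] sum.atMost_Suc by (simp only: add.assoc)
qed

lemma em_continuation_stable:
  assumes "mzeta_continuation r F" "J \<ge> em_order r B" "s \<in> coord_box (Suc r) B" "s \<in> complex_space (Suc r)"
  shows "em_continuation r F J s = em_continuation r F (em_order r B) s"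
  using assms(2)
  by (induction J rule: dec_induct) (simp_all add: em_continuation_Suc[OF assms(1) _ assms(3,4)])

lemma em_continuation_limit:
  assumes "mzeta_continuation r F" "J \<ge> em_order r B" "s \<in> coord_box (Suc r) B" "s \<in> complex_space (Suc r)"
  shows "lim (\<lambda>J. em_continuation r F J s) = em_continuation r F J s"
proof (rule limI)
  have "\<forall>\<^sub>F J' in sequentially. em_continuation r F J s = em_continuation r F J' s"
    by (rule eventually_mono[OF eventually_ge_at_top[of "em_order r B"]])
      (metis em_continuation_stable assms)
  then show "(\<lambda>J. em_continuation r F J s) \<longlonglongrightarrow> em_continuation r F J s"
    by (rule Lim_transform_eventually[OF tendsto_const])
qed

text \<open>The limit over the order gives one function without reference to a box; inside a box the
  sequence is constant from \<open>em_order r B\<close> on.\<close>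

lemma mzeta_continuation_step:
  assumes F: "mzeta_continuation r F"
  shows "mzeta_continuation (Suc r) (\<lambda>s. lim (\<lambda>J. em_continuation r F J s))"
  unfolding mzeta_continuation_def
proof (intro conjI ballI)
  show "holomorphic_several (Suc r) (\<lambda>s. lim (\<lambda>J. em_continuation r F J s)) (regular_points (Suc r))"
  proof (rule holomorphic_several_box_cover)
    show "holomorphic_several (Suc r) (em_continuation r F (em_order r B))
        (regular_points (Suc r) \<inter> coord_box (Suc r) B)" for B
      by (rule holomorphic_several_em_continuation[OF F order_refl])
    show "lim (\<lambda>J. em_continuation r F J s) = em_continuation r F (em_order r B) s"
      if "s \<in> regular_points (Suc r)" "s \<in> coord_box (Suc r) B" for B s
      by (rule em_continuation_limit[OF F order_refl that(2)]) (use that(1) in \<open>simp add: regular_points_def\<close>)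
  qed
  fix s assume s: "s \<in> convergence_region (Suc r)"
  obtain B where B: "s \<in> coord_box (Suc r) B" using coord_box_exhausts by blast
  show "lim (\<lambda>J. em_continuation r F J s) = mzeta_series (Suc r) s"
    using em_continuation_limit[OF F order_refl B] em_continuation_eq_series[OF F order_refl B s] s
    by (simp add: convergence_region_def)
qed

lemma mzeta_continuation_0: "mzeta_continuation 0 (\<lambda>_. 1)"
proof -
  have "increasing_tuples 0 = {\<lambda>_. undefined}"
    by (auto simp: increasing_tuples_def strict_mono_on_def)
  then show ?thesis
    by (simp add: mzeta_continuation_def holomorphic_several_def mzeta_series_def)
qed

lemma mzeta_continuation_mzeta: "mzeta_continuation r (mzeta r)"
proof -
  have "\<exists>F. mzeta_continuation r F"
  proof (induction r)
    case 0
    then show ?case using mzeta_continuation_0 by blast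
  next
    case (Suc r)
    then show ?case using mzeta_continuation_step by blast
  qed
  then show ?thesis unfolding mzeta_def by (rule someI_ex)
qed

lemma mzeta_eq_em_continuation:
  assumes "s \<in> regular_points (Suc r)" "s \<in> coord_box (Suc r) B" "J \<ge> em_order r B"
  shows "mzeta (Suc r) s = em_continuation r (mzeta r) J s"
proof -
  have "mzeta (Suc r) s = lim (\<lambda>J. em_continuation r (mzeta r) J s)"
    by (rule mzeta_continuation_unique[OF _ mzeta_continuation_mzeta
          mzeta_continuation_step[OF mzeta_continuation_mzeta] assms(1)]) simp
  also have "\<dots> = em_continuation r (mzeta r) J s"
    by (rule em_continuation_limit[OF mzeta_continuation_mzeta assms(3,2)])
      (use assms(1) in \<open>simp add: regular_points_def\<close>)
  finally show ?thesis .
qed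

section \<open>Elimination of nonpositive entries\<close>

text \<open>For \<open>j \<le> N\<close>, minus this number is the coefficient of
  \<open>x^(N + 1 - j)\<close> in \<open>1^N + ... + x^N\<close>. The sign arises because
  \<open>em_term\<close> approximates the sum over \<open>m > x\<close>.\<close>

definition faulhaber_coeff :: "nat \<Rightarrow> nat \<Rightarrow> complex" where
  "faulhaber_coeff N j = em_coeff (- of_nat N) j / (- of_nat N - 1)"

lemma faulhaber_coeff_rational: "faulhaber_coeff N j \<in> \<rat>"
proof -
  have "pochhammer (- of_nat N - 1 :: complex) j = of_int (pochhammer (- int N - 1) j)"
    by (simp add: pochhammer_prod)
  then have "em_coeff (- of_nat N) j \<in> \<rat>" by (simp add: em_coeff_def)
  moreover have "(- of_nat N - 1 :: complex) = of_int (- int N - 1)" by simp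
  ultimately show ?thesis unfolding faulhaber_coeff_def by (metis Rats_divide Rats_of_int)
qed

lemma faulhaber_coeff_odd: "odd j \<Longrightarrow> j \<noteq> 1 \<Longrightarrow> faulhaber_coeff N j = 0"
  by (simp add: faulhaber_coeff_def em_coeff_odd)

lemma minus_nat_minus_1_neq_0: "(- of_nat N - 1 :: complex) \<noteq> 0"
proof
  assume *: "(- of_nat N - 1 :: complex) = 0"
  have "(of_nat (Suc N) :: complex) = - (- of_nat N - 1)" by simp
  then have "(of_nat (Suc N) :: complex) = 0" unfolding * by simp
  then show False by (simp only: of_nat_eq_0_iff)
qed

lemma em_coeff_eq_faulhaber: "em_coeff (- of_nat N) j = (- of_nat N - 1) * faulhaber_coeff N j"
  using minus_nat_minus_1_neq_0[of N] by (simp add: faulhaber_coeff_def)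

lemma mzeta_last_nonpos:
  assumes s: "s \<in> regular_points (Suc r)" and N: "s (Suc r) = - of_nat N"
  shows "mzeta (Suc r) s = (if r = 0 then 1 else 0)
    + (\<Sum>j\<le>Suc N. faulhaber_coeff N j * mzeta r (merge_point r r (of_nat j - 1) s))"
proof -
  define c where "c = (- of_nat N - 1 :: complex)"
  have c: "c \<noteq> 0" unfolding c_def by (rule minus_nat_minus_1_neq_0)
  obtain B where B: "s \<in> coord_box (Suc r) B" using coord_box_exhausts by blast
  \<comment> \<open>Large enough for the continuation formula to apply, for the error terms to
    vanish and for all nonzero coefficients to be included.\<close>
  define J where "J = max (em_order r B) (Suc N)"
  have "em_series r J s = 0"
    by (simp add: em_series_def N em_error_neg_nat J_def)
  moreover have "(\<Sum>j\<le>J. em_coeff (- of_nat N) j * mzeta r (merge_point r r (of_nat j - 1) s)) =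
      (\<Sum>j\<le>Suc N. em_coeff (- of_nat N) j * mzeta r (merge_point r r (of_nat j - 1) s))"
    by (rule sum.mono_neutral_right) (auto simp: J_def em_coeff_neg_nat)
  moreover have "\<dots> = c * (\<Sum>j\<le>Suc N. faulhaber_coeff N j * mzeta r (merge_point r r (of_nat j - 1) s))"
    by (simp only: em_coeff_eq_faulhaber c_def sum_distrib_left mult.assoc)
  ultimately show ?thesis
    using mzeta_eq_em_continuation[OF s B, of J] c
    unfolding em_continuation_def N c_def[symmetric]
    by (simp add: J_def add_divide_distrib del: sum.atMost_Suc)
qed

text \<open>In the application \<open>M + 1\<close> is the next variable, so the boundary term has
  to be written in powers of \<open>M + 1\<close>. By exact telescoping \<open>em_term\<close> at
  \<open>M\<close> is the one at \<open>M + 1\<close> plus \<open>(s - 1) (M + 1)^N\<close>, and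
  this is the power with \<open>j = 1\<close>: hence the extra \<open>1\<close>. For
  \<open>p = 0\<close> the two constants combine to \<open>\<zeta>(-N)\<close>.\<close>

lemma mzpart_nonpos_last:
  assumes N: "s (Suc p) = - of_nat N"
  shows "mzpart (Suc p) s M = (if p = 0 then 1 else 0)
     + (\<Sum>j\<le>Suc N. faulhaber_coeff N j * mzpart p (merge_entries p (of_nat j - 1) s) M)
     - (\<Sum>j\<le>Suc N. (faulhaber_coeff N j + (if j = 1 then 1 else 0))
          * of_nat (Suc M) powr (1 + of_nat N - of_nat j)) * mzpart p s M"
proof -
  define z where "z = (- of_nat N :: complex)"
  define x where "x = (of_nat (Suc M) :: complex)"
  define T where "T = (\<Sum>j\<le>Suc N. faulhaber_coeff N j * x powr (1 + of_nat N - of_nat j))"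
  have c: "z - 1 \<noteq> 0" unfolding z_def by (rule minus_nat_minus_1_neq_0)
  have "(\<Sum>j\<le>Suc N. (if j = 1 then 1 else 0) * x powr (1 + of_nat N - of_nat j)) =
      (\<Sum>j\<in>{..Suc N}. if j = 1 then x powr of_nat N else 0)"
    by (intro sum.cong) auto
  also have "\<dots> = x powr of_nat N" by (subst sum.delta) auto
  finally have T': "(\<Sum>j\<le>Suc N. (faulhaber_coeff N j + (if j = 1 then 1 else 0))
          * x powr (1 + of_nat N - of_nat j)) = T + x powr of_nat N"
    by (simp only: T_def distrib_right sum.distrib)
  define A where "A = (\<Sum>j\<le>Suc N. faulhaber_coeff N j * mzpart p (merge_entries p (of_nat j - 1) s) M)"
  have "mzpart (Suc p) s M = (if p = 0 then 1 else 0) + A - (T + x powr of_nat N) * mzpart p s M"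
  proof (cases "M = 0")
    case True
    show ?thesis
      by (cases "p = 0") (simp_all add: True mzpart_at_0 A_def T_def x_def)
  next
    case False
    then have M: "M \<ge> 1" by simp
    have err: "em_error (Suc N) z m = 0" if "m \<ge> 2" for m
      unfolding z_def by (rule em_error_neg_nat) (use that in auto)
    have T: "em_term (Suc N) z (Suc M) = (z - 1) * T"
      unfolding em_term_def T_def z_def em_coeff_eq_faulhaber x_def
      by (simp only: sum_distrib_left mult.assoc diff_minus_eq_add)
    have "em_error (Suc N) z (Suc M) = (z - 1) * x powr of_nat N - em_term (Suc N) z M + em_term (Suc N) z (Suc M)"
      by (simp add: em_error_def x_def z_def del: of_nat_Suc)
    then have T2: "em_term (Suc N) z M = (z - 1) * (T + x powr of_nat N)"
      using err[of "Suc M"] M T by (simp add: algebra_simps)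
    have "(z - 1) * mzpart (Suc p) s M = (if p = 0 then z - 1 else 0) + (z - 1) * A - em_term (Suc N) z M * mzpart p s M + 0"
    proof -
      have "(\<Sum>m=2..M. em_error (Suc N) z m * mzpart p s (m - 1)) = 0"
        by (rule sum.neutral) (simp add: err)
      moreover have "(\<Sum>j\<le>Suc N. em_coeff z j * mzpart p (merge_entries p (of_nat j - 1) s) M) = (z - 1) * A"
        by (simp only: A_def z_def em_coeff_eq_faulhaber sum_distrib_left mult.assoc)
      ultimately show ?thesis
        using mzpart_euler_maclaurin[OF M, of s p "Suc N"] unfolding N z_def[symmetric] by simp
    qed
    also have "\<dots> = (z - 1) * ((if p = 0 then 1 else 0) + A - (T + x powr of_nat N) * mzpart p s M)"
      unfolding T2 by (simp add: algebra_simps)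
    finally show ?thesis using c by simp
  qed
  then show ?thesis unfolding A_def T'[unfolded x_def] x_def .
qed

text \<open>When the entry \<open>Suc p\<close> is directly followed by the last variable,
  \<open>mzpart_nonpos_last\<close> is inserted for the inner sum. The powers of the outer variable
  are absorbed into its exponent, which is the merge at \<open>Suc p\<close>; the remaining terms
  form the merge at \<open>p\<close>. Further outer summations act on both sides alike.\<close>

lemma mzpart_eliminate_nonpos:
  assumes N: "s (Suc p) = - of_nat N" and r: "Suc p \<le> r"
  shows "mzpart (Suc r) s M =
     (\<Sum>j\<le>Suc N. faulhaber_coeff N j * mzpart r (merge_entries p (of_nat j - 1) s) M)
     - (\<Sum>j\<le>Suc N. (faulhaber_coeff N j + (if j = 1 then 1 else 0)) * mzpart r (merge_entries (Suc p) (of_nat j - 1) s) M)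
     + (if p = 0 then mzpart r (merge_entries 0 0 s) M else 0)"
  using r
proof (induction r arbitrary: M rule: dec_induct)
  case base
  define u where "u x = (of_nat x :: complex) powr (- s (Suc (Suc p)))" for x :: nat
  define c' where "c' j = faulhaber_coeff N j + (if j = 1 then 1 else 0)" for j
  have A: "mzpart (Suc p) (merge_entries p c s) M = (\<Sum>x=1..M. u x * mzpart p (merge_entries p c s) (x - 1))" for c
    by (simp add: merge_entries_def u_def)
  have A0: "mzpart (Suc p) (merge_entries 0 0 s) M = (\<Sum>x=1..M. u x)" if "p = 0"
    using that by (simp add: merge_entries_def u_def)
  have B: "mzpart (Suc p) (merge_entries (Suc p) (of_nat j - 1) s) M =
      (\<Sum>x=1..M. u x * (of_nat x powr (1 + of_nat N - of_nat j) * mzpart p s (x - 1)))" for j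
  proof -
    have "mzpart p (merge_entries (Suc p) (of_nat j - 1) s) x = mzpart p s x" for x
      by (rule mzpart_cong) (simp add: merge_entries_def)
    moreover have "(of_nat x :: complex) powr (- merge_entries (Suc p) (of_nat j - 1) s (Suc p)) =
        u x * of_nat x powr (1 + of_nat N - of_nat j)" for x :: nat
      unfolding u_def powr_add[symmetric] by (simp add: merge_entries_def N algebra_simps)
    ultimately show ?thesis by (simp add: mult.assoc)
  qed
  have "mzpart (Suc (Suc p)) s M = (\<Sum>x=1..M. u x * ((if p = 0 then 1 else 0)
     + (\<Sum>j\<le>Suc N. faulhaber_coeff N j * mzpart p (merge_entries p (of_nat j - 1) s) (x - 1))
     - (\<Sum>j\<le>Suc N. c' j * of_nat x powr (1 + of_nat N - of_nat j)) * mzpart p s (x - 1)))"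
    unfolding mzpart.simps(2)[of "Suc p"]
  proof (rule sum.cong[OF refl])
    fix x assume "x \<in> {1..M}"
    then have "Suc (x - 1) = x" by simp
    then show "of_nat x powr (- s (Suc (Suc p))) * mzpart (Suc p) s (x - 1) = u x * ((if p = 0 then 1 else 0)
     + (\<Sum>j\<le>Suc N. faulhaber_coeff N j * mzpart p (merge_entries p (of_nat j - 1) s) (x - 1))
     - (\<Sum>j\<le>Suc N. c' j * of_nat x powr (1 + of_nat N - of_nat j)) * mzpart p s (x - 1))"
      using mzpart_nonpos_last[where p = p and s = s and M = "x - 1", OF N] by (simp only: u_def c'_def)
  qed
  also have "\<dots> = (\<Sum>x=1..M. if p = 0 then u x else 0)
     + (\<Sum>x=1..M. \<Sum>j\<le>Suc N. faulhaber_coeff N j * (u x * mzpart p (merge_entries p (of_nat j - 1) s) (x - 1)))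
     - (\<Sum>x=1..M. \<Sum>j\<le>Suc N. c' j * (u x * (of_nat x powr (1 + of_nat N - of_nat j) * mzpart p s (x - 1))))"
    unfolding sum.distrib[symmetric] sum_subtractf[symmetric]
  proof (rule sum.cong[OF refl])
    fix x
    show "u x * ((if p = 0 then 1 else 0)
     + (\<Sum>j\<le>Suc N. faulhaber_coeff N j * mzpart p (merge_entries p (of_nat j - 1) s) (x - 1))
     - (\<Sum>j\<le>Suc N. c' j * of_nat x powr (1 + of_nat N - of_nat j)) * mzpart p s (x - 1))
     = (if p = 0 then u x else 0)
     + (\<Sum>j\<le>Suc N. faulhaber_coeff N j * (u x * mzpart p (merge_entries p (of_nat j - 1) s) (x - 1)))
     - (\<Sum>j\<le>Suc N. c' j * (u x * (of_nat x powr (1 + of_nat N - of_nat j) * mzpart p s (x - 1))))"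
      by (simp add: distrib_left right_diff_distrib sum_distrib_left sum_distrib_right mult.left_commute mult.assoc
        del: sum.atMost_Suc)
  qed
  also have "\<dots> = (\<Sum>x=1..M. if p = 0 then u x else 0)
     + (\<Sum>j\<le>Suc N. faulhaber_coeff N j * mzpart (Suc p) (merge_entries p (of_nat j - 1) s) M)
     - (\<Sum>j\<le>Suc N. c' j * mzpart (Suc p) (merge_entries (Suc p) (of_nat j - 1) s) M)"
    unfolding A B sum_distrib_left by (simp only: sum.swap[of _ "{..Suc N}"])
  finally show ?case using A0 by (cases "p = 0") (simp_all add: c'_def del: mzpart.simps sum.atMost_Suc)
next
  case (step r)
  define u where "u x = (of_nat x :: complex) powr (- s (Suc (Suc r)))" for x :: nat
  define c' where "c' j = faulhaber_coeff N j + (if j = 1 then 1 else 0)" for j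
  have A: "mzpart (Suc r) (merge_entries q c s) M = (\<Sum>x=1..M. u x * mzpart r (merge_entries q c s) (x - 1))"
    if "q \<le> Suc p" for q c
    using step.hyps that by (simp add: merge_entries_def u_def)
  have "mzpart (Suc (Suc r)) s M = (\<Sum>x=1..M. u x * mzpart (Suc r) s (x - 1))"
    by (simp add: u_def)
  also have "\<dots> = (\<Sum>x=1..M.
     (\<Sum>j\<le>Suc N. faulhaber_coeff N j * (u x * mzpart r (merge_entries p (of_nat j - 1) s) (x - 1)))
     - (\<Sum>j\<le>Suc N. c' j * (u x * mzpart r (merge_entries (Suc p) (of_nat j - 1) s) (x - 1)))
     + (if p = 0 then u x * mzpart r (merge_entries 0 0 s) (x - 1) else 0))"
    unfolding step.IH c'_def
    by (intro sum.cong refl)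
      (simp add: distrib_left right_diff_distrib sum_distrib_left mult.left_commute del: sum.atMost_Suc)
  also have "\<dots> = (\<Sum>j\<le>Suc N. faulhaber_coeff N j * mzpart (Suc r) (merge_entries p (of_nat j - 1) s) M)
     - (\<Sum>j\<le>Suc N. c' j * mzpart (Suc r) (merge_entries (Suc p) (of_nat j - 1) s) M)
     + (if p = 0 then mzpart (Suc r) (merge_entries 0 0 s) M else 0)"
    unfolding sum.distrib sum_subtractf sum_distrib_left
    by (subst (1 2) sum.swap) (simp add: A sum_distrib_left del: sum.atMost_Suc mzpart.simps)
  finally show ?case unfolding c'_def .
qed

lemma open_convergence_slice: "open {z. s(i := z) \<in> convergence_region r}" if "s \<in> complex_space r" "i \<in> {1..r}"
proof -
  have "s(i := z) \<in> complex_space r" for z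
    using that by (auto simp: complex_space_def PiE_def extensional_def)
  then have "{z. s(i := z) \<in> convergence_region r} =
      (\<Inter>k\<in>{1..r}. {z. real k < Re (last_sum r k (s(i := z)))})"
    by (auto simp: convergence_region_def)
  moreover have "open {z. real k < Re (last_sum r k (s(i := z)))}" for k
    unfolding last_sum_def
    by (intro open_Collect_less continuous_on_const continuous_on_Re continuous_on_sum
        holomorphic_on_imp_continuous_on holomorphic_on_upd)
  ultimately show ?thesis by (simp add: open_INT)
qed

text \<open>Each singular hyperplane meets the slice in a single point, so only countably many
  points are removed from the plane.\<close>

lemma connected_last_regular_slice:
  assumes r: "r \<ge> 1" and s: "s \<in> complex_space r"
  shows "connected {z. s(r := z) \<in> regular_points r}" (is "connected ?D")
proof -
  have sp: "s(r := z) \<in> complex_space r" for z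
    using s r by (auto simp: complex_space_def PiE_def extensional_def)
  have "- ?D \<subseteq> (\<Union>k\<in>{1..r}. (\<lambda>c. of_int c - last_sum r k (s(r := 0))) ` UNIV)"
  proof
    fix z assume "z \<in> - ?D"
    then obtain k c where k: "k \<in> {1..r}" and "last_sum r k (s(r := z)) = of_int c"
      using sp by (auto simp: regular_points_def)
    then have "z = of_int c - last_sum r k (s(r := 0))"
      using last_sum_upd[OF k, of s z] by (simp add: algebra_simps)
    then show "z \<in> (\<Union>k\<in>{1..r}. (\<lambda>c. of_int c - last_sum r k (s(r := 0))) ` UNIV)"
      using k by blast
  qed
  then have "countable (- ?D)"
    by (rule countable_subset) (intro countable_UN countable_image; simp)
  then have "connected (UNIV - (- ?D))"
    by (intro connected_open_diff_countable) auto
  then show ?thesis by (simp add: Compl_eq_Diff_UNIV [symmetric])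
qed

text \<open>Every last sum contains the last coordinate exactly once, so one large real value serves
  all \<open>k\<close>.\<close>

lemma last_slice_meets_convergence_region:
  assumes r: "r \<ge> 1" and s: "s \<in> complex_space r"
  shows "\<exists>z. s(r := z) \<in> convergence_region r"
proof -
  define z where "z = 1 + (\<Sum>k=1..r. \<bar>real k - Re (last_sum r k (s(r := 0)))\<bar>)"
  have "real k < Re (last_sum r k (s(r := of_real z)))" if k: "k \<in> {1..r}" for k
  proof -
    have "\<bar>real k - Re (last_sum r k (s(r := 0)))\<bar> < z"
      using member_le_sum[of k "{1..r}" "\<lambda>k. \<bar>real k - Re (last_sum r k (s(r := 0)))\<bar>"] k
      by (auto simp: z_def)
    then show ?thesis using last_sum_upd[OF k, of s "of_real z"] by simp
  qed
  moreover have "s(r := of_real z) \<in> complex_space r"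
    using s r by (auto simp: complex_space_def PiE_def extensional_def)
  ultimately show ?thesis by (auto simp: convergence_region_def)
qed

text \<open>Only the last coordinate moves, so the entry \<open>-N\<close> stays fixed while the
  slice reaches the region of convergence. There the truncated identity passes to the limit, because
  corrections \<open>j - 1 \<ge> -1\<close> keep all merged points convergent.\<close>

lemma mzeta_eliminate_nonpos:
  assumes s: "s \<in> regular_points (Suc r)" and N: "s (Suc p) = - of_nat N" and p: "Suc p \<le> r"
  shows "mzeta (Suc r) s =
     (\<Sum>j\<le>Suc N. faulhaber_coeff N j * mzeta r (merge_point r p (of_nat j - 1) s))
     - (\<Sum>j\<le>Suc N. (faulhaber_coeff N j + (if j = 1 then 1 else 0)) * mzeta r (merge_point r (Suc p) (of_nat j - 1) s))
     + (if p = 0 then mzeta r (merge_point r 0 0 s) else 0)" (is "_ = ?R s")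
proof -
  define D where "D = {z. s(Suc r := z) \<in> regular_points (Suc r)}"
  define E where "E = {z. s(Suc r := z) \<in> convergence_region (Suc r)}"
  have sp: "s \<in> complex_space (Suc r)" using s by (simp add: regular_points_def)
  have hF: "holomorphic_several q (mzeta q) (regular_points q)" for q
    using mzeta_continuation_mzeta by (simp add: mzeta_continuation_def)
  have ser: "mzeta q t = mzeta_series q t" if "t \<in> convergence_region q" for q t
    using mzeta_continuation_mzeta that by (simp add: mzeta_continuation_def)
  have hol: "(\<lambda>z. mzeta r (merge_point r i (of_nat j - 1) (s(Suc r := z)))) holomorphic_on D"
    if "i \<le> r" "\<not> (odd j \<and> j \<noteq> 1)" for i j
    by (rule holomorphic_on_merge_point[OF hF _ that(1)])
      (use that in \<open>auto simp: D_def intro!: merge_point_regular\<close>)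
  have hol1: "(\<lambda>z. faulhaber_coeff N j * mzeta r (merge_point r p (of_nat j - 1) (s(Suc r := z)))) holomorphic_on D" for j
    by (cases "odd j \<and> j \<noteq> 1")
      (use p in \<open>auto simp: faulhaber_coeff_odd intro!: holomorphic_on_mult hol\<close>)
  have hol2: "(\<lambda>z. (faulhaber_coeff N j + (if j = 1 then 1 else 0)) *
      mzeta r (merge_point r (Suc p) (of_nat j - 1) (s(Suc r := z)))) holomorphic_on D" for j
  proof (cases "odd j \<and> j \<noteq> 1")
    case False
    then show ?thesis by (intro holomorphic_on_mult holomorphic_on_const hol p)
  qed (simp add: faulhaber_coeff_odd)
  have hol3: "(\<lambda>z. if p = 0 then mzeta r (merge_point r 0 0 (s(Suc r := z))) else 0) holomorphic_on D"
    using hol[of 0 1] by (cases "p = 0") auto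
  have "mzeta (Suc r) (s(Suc r := s (Suc r))) = ?R (s(Suc r := s (Suc r)))"
  proof (rule analytic_continuation_open[where s = E and s' = D and f = "\<lambda>z. mzeta (Suc r) (s(Suc r := z))"
        and g = "\<lambda>z. ?R (s(Suc r := z))"])
    show "open E" unfolding E_def by (rule open_convergence_slice[OF sp]) simp
    show "open D" unfolding D_def by (rule open_regular_slice) simp
    show "E \<noteq> {}" using last_slice_meets_convergence_region[OF _ sp] by (auto simp: E_def)
    show "connected D" unfolding D_def by (rule connected_last_regular_slice[OF _ sp]) simp
    show "E \<subseteq> D" using convergence_region_in_regular by (auto simp: D_def E_def)
    show "s (Suc r) \<in> D" using s by (simp add: D_def)
    show "(\<lambda>z. mzeta (Suc r) (s(Suc r := z))) holomorphic_on D"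
      using hF[of "Suc r"] s unfolding holomorphic_several_def D_def by auto
    show "(\<lambda>z. ?R (s(Suc r := z))) holomorphic_on D"
      by (intro holomorphic_on_add holomorphic_on_diff holomorphic_on_sum hol1 hol2 hol3)
    show "mzeta (Suc r) (s(Suc r := z)) = ?R (s(Suc r := z))" if "z \<in> E" for z
    proof -
      define t where "t = s(Suc r := z)"
      have t: "t \<in> convergence_region (Suc r)" using that by (simp add: E_def t_def)
      have tN: "t (Suc p) = - of_nat N" using N p by (simp add: t_def)
      have lim: "(\<lambda>M. mzpart r (merge_entries i c t) M) \<longlonglongrightarrow> mzeta r (merge_point r i c t)"
        if "i \<le> r" "Re c \<ge> -1" for i c
      proof -
        have "merge_point r i c t \<in> convergence_region r" by (rule merge_point_convergence[OF t that])
        then show ?thesis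
          using mzpart_tendsto_mzeta_series[of "merge_point r i c t" r] by (simp add: ser mzpart_merge_point)
      qed
      have "(\<lambda>M. mzpart (Suc r) t M) \<longlonglongrightarrow> ?R t"
        unfolding mzpart_eliminate_nonpos[where s = t and p = p, OF tN p]
      proof (intro tendsto_add tendsto_diff tendsto_sum tendsto_mult tendsto_const lim)
        show "(\<lambda>M. if p = 0 then mzpart r (merge_entries 0 0 t) M else 0) \<longlonglongrightarrow>
            (if p = 0 then mzeta r (merge_point r 0 0 t) else 0)"
          using lim[of 0 0] by (cases "p = 0") auto
      qed (use p in auto)
      moreover have "(\<lambda>M. mzpart (Suc r) t M) \<longlonglongrightarrow> mzeta (Suc r) t"
        using mzpart_tendsto_mzeta_series[OF t] by (simp only: ser[OF t])
      ultimately have "mzeta (Suc r) t = ?R t" using LIMSEQ_unique by blast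
      then show ?thesis by (simp only: t_def)
    qed
  qed
  then show ?thesis by (simp only: fun_upd_triv)
qed

section \<open>Rational spans of multiple zeta values and the induction on depth\<close>

lemma module_rat_complex: "module (\<lambda>(q::rat) (z::complex). of_rat q * z)"
  by unfold_locales (simp_all add: algebra_simps of_rat_add of_rat_mult)

lemma mzv_space_base:
  "n \<le> a \<Longrightarrow> admissible n m \<Longrightarrow> (\<Sum>i=1..n. m i) \<le> int b \<Longrightarrow> mzv n m \<in> mzv_space a b"
  unfolding mzv_space_def rat_span_def
  by (rule module.span_base[OF module_rat_complex]) blast

lemma mzv_space_mono: "a \<le> a' \<Longrightarrow> b \<le> b' \<Longrightarrow> mzv_space a b \<subseteq> mzv_space a' b'"
  unfolding mzv_space_def rat_span_def
  by (rule module.span_mono[OF module_rat_complex]) force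

lemma mzv_space_add: "x \<in> mzv_space a b \<Longrightarrow> y \<in> mzv_space a b \<Longrightarrow> x + y \<in> mzv_space a b"
  unfolding mzv_space_def rat_span_def by (rule module.span_add[OF module_rat_complex])

lemma mzv_space_scale: "q \<in> \<rat> \<Longrightarrow> x \<in> mzv_space a b \<Longrightarrow> q * x \<in> mzv_space a b"
  unfolding mzv_space_def rat_span_def
  by (elim Rats_cases) (simp add: module.span_scale[OF module_rat_complex])

lemma mzv_space_diff:
  assumes "x \<in> mzv_space a b" "y \<in> mzv_space a b"
  shows "x - y \<in> mzv_space a b"
  using mzv_space_add[OF assms(1) mzv_space_scale[OF _ assms(2), of "-1"]] by simp

lemma mzv_space_sum: "(\<And>i. i \<in> I \<Longrightarrow> f i \<in> mzv_space a b) \<Longrightarrow> sum f I \<in> mzv_space a b"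
  unfolding mzv_space_def rat_span_def by (rule module.span_sum[OF module_rat_complex])

lemma mzv_space_0: "0 \<in> mzv_space a b"
  unfolding mzv_space_def rat_span_def by (rule module.span_zero[OF module_rat_complex])

lemma mzv_space_1: "1 \<in> mzv_space a b"
  using mzv_space_base[of 0 a "\<lambda>_. 0" b] by (simp add: mzv_def admissible_def)

lemma sum_merge_entries_le:
  fixes f :: "int \<Rightarrow> nat"
  assumes "i \<le> r" "i \<ge> 1 \<Longrightarrow> f (n i + n (Suc i) + c) \<le> f (n i) + f (n (Suc i))"
  shows "(\<Sum>l=1..r. f (merge_entries i c n l)) \<le> (\<Sum>l=1..Suc r. f (n l))"
  using assms(1)
proof (induction r rule: dec_induct)
  case base
  show ?case
  proof (cases i)
    case (Suc q)
    have "(\<Sum>l=1..q. f (merge_entries i c n l)) = (\<Sum>l=1..q. f (n l))"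
      by (rule sum.cong) (auto simp: merge_entries_def Suc)
    then show ?thesis using assms(2) by (simp add: Suc merge_entries_def)
  qed simp
next
  case (step r)
  then show ?case by (simp add: merge_entries_def)
qed

text \<open>A sum of a function of single entries rather than a cardinality, so that
  \<open>sum_merge_entries_le\<close> covers the count and the weight alike.\<close>

definition positive_count :: "nat \<Rightarrow> (nat \<Rightarrow> int) \<Rightarrow> nat" where
  "positive_count r n = (\<Sum>l=1..r. if n l > 0 then 1 else 0)"

definition positive_weight :: "nat \<Rightarrow> (nat \<Rightarrow> int) \<Rightarrow> nat" where
  "positive_weight r n = (\<Sum>l=1..r. nat (n l))"

lemma positive_merge_le:
  assumes "i \<le> r" "i \<ge> 1 \<Longrightarrow> n i + n (Suc i) + c \<le> max (n i) (n (Suc i))"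
  shows "positive_count r (merge_entries i c n) \<le> positive_count (Suc r) n"
    and "positive_weight r (merge_entries i c n) \<le> positive_weight (Suc r) n"
  unfolding positive_count_def positive_weight_def
  by (rule sum_merge_entries_le[OF assms(1), where f = "\<lambda>x. if x > 0 then 1 else 0"]; use assms(2) in force)
    (rule sum_merge_entries_le[OF assms(1), where f = nat]; use assms(2) in force)

lemma int_point_merge_entries:
  assumes "i \<le> r"
  shows "int_point r (merge_entries i c n) = merge_point r i (of_int c) (int_point (Suc r) n)"
  using assms
  by (auto simp: int_point_def merge_point_def merge_entries_def restrict_def fun_eq_iff)

lemma mzeta_int_point_in_mzv_space:
  assumes "int_point r n \<in> regular_points r"
  shows "mzeta r (int_point r n) \<in> mzv_space (positive_count r n) (positive_weight r n)"
  using assms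
proof (induction r arbitrary: n)
  case 0
  have "mzeta 0 (int_point 0 n) = 1"
    using mzeta_continuation_mzeta[of 0]
    by (simp add: mzeta_continuation_def convergence_region_def complex_space_def int_point_def
        mzeta_series_def increasing_tuples_def strict_mono_on_def restrict_def)
  then show ?case by (simp add: mzv_space_1)
next
  case (Suc r)
  define s where "s = int_point (Suc r) n"
  define V where "V = mzv_space (positive_count (Suc r) n) (positive_weight (Suc r) n)"
  have s: "s \<in> regular_points (Suc r)" using Suc.prems by (simp add: s_def)
  have merge: "mzeta r (merge_point r i (of_nat j - 1) s) \<in> V"
    if i: "i \<le> r" "i \<ge> 1 \<Longrightarrow> n i + n (Suc i) + (int j - 1) \<le> max (n i) (n (Suc i))"
      and j: "odd j \<Longrightarrow> j = 1" for i j
  proof -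
    have e: "merge_point r i (of_nat j - 1) s = int_point r (merge_entries i (int j - 1) n)"
      unfolding int_point_merge_entries[OF i(1)] s_def by simp
    have "int_point r (merge_entries i (int j - 1) n) \<in> regular_points r"
      unfolding e[symmetric] by (rule merge_point_regular[OF s i(1) j])
    then show ?thesis
      unfolding e V_def
      using Suc.IH mzv_space_mono[OF positive_merge_le[OF i]] by blast
  qed
  have s_nth: "s l = of_int (n l)" if "l \<in> {1..Suc r}" for l
    using that by (simp add: s_def int_point_def)
  have term1: "faulhaber_coeff N j * mzeta r (merge_point r i (of_nat j - 1) s) \<in> V"
    if "i \<le> r" "i \<ge> 1 \<Longrightarrow> n i + n (Suc i) + (int j - 1) \<le> max (n i) (n (Suc i))" for N i j
  proof (cases "odd j \<and> j \<noteq> 1")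
    case True
    then show ?thesis by (simp add: faulhaber_coeff_odd V_def mzv_space_0)
  next
    case False
    then have "mzeta r (merge_point r i (of_nat j - 1) s) \<in> V" using merge that by blast
    then show ?thesis unfolding V_def by (rule mzv_space_scale[OF faulhaber_coeff_rational])
  qed
  consider "n (Suc r) \<le> 0" | "n (Suc r) > 0" "\<exists>i\<in>{1..r}. n i \<le> 0" | "n (Suc r) > 0" "\<forall>i\<in>{1..r}. n i > 0"
    by force
  then show ?case
  proof cases
    case 1
    define N where "N = nat (- n (Suc r))"
    have N: "n (Suc r) = - int N" using 1 by (simp add: N_def)
    have "mzeta (Suc r) s = (if r = 0 then 1 else 0)
      + (\<Sum>j\<le>Suc N. faulhaber_coeff N j * mzeta r (merge_point r r (of_nat j - 1) s))"
      by (rule mzeta_last_nonpos[OF s]) (simp add: s_nth N)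
    also have "\<dots> \<in> V"
      unfolding V_def
    proof (intro mzv_space_add mzv_space_sum)
      show "(if r = 0 then 1 else 0) \<in> mzv_space (positive_count (Suc r) n) (positive_weight (Suc r) n)"
        by (simp add: mzv_space_0 mzv_space_1)
      fix j assume "j \<in> {..Suc N}"
      \<comment> \<open>As \<open>j - 1 \<le> N\<close>, the correction at most compensates the
        entry \<open>-N\<close>, so the merged entry does not exceed its neighbour.\<close>
      then have "n r + n (Suc r) + (int j - 1) \<le> max (n r) (n (Suc r))" by (simp add: N)
      then show "faulhaber_coeff N j * mzeta r (merge_point r r (of_nat j - 1) s)
          \<in> mzv_space (positive_count (Suc r) n) (positive_weight (Suc r) n)"
        using term1[of r j N] by (simp add: V_def)
    qed
    finally show ?thesis by (simp add: s_def V_def)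
  next
    case 2
    then obtain i where i: "i \<in> {1..r}" "n i \<le> 0" by blast
    then obtain p where p: "i = Suc p" by (cases i) auto
    define N where "N = nat (- n (Suc p))"
    have N: "n (Suc p) = - int N" using i p by (simp add: N_def)
    have pr: "Suc p \<le> r" using i p by simp
    have "mzeta (Suc r) s = (\<Sum>j\<le>Suc N. faulhaber_coeff N j * mzeta r (merge_point r p (of_nat j - 1) s))
     - (\<Sum>j\<le>Suc N. (faulhaber_coeff N j + (if j = 1 then 1 else 0)) * mzeta r (merge_point r (Suc p) (of_nat j - 1) s))
     + (if p = 0 then mzeta r (merge_point r 0 0 s) else 0)"
      by (rule mzeta_eliminate_nonpos[OF s _ pr]) (use pr in \<open>simp add: s_nth N\<close>)
    also have "\<dots> \<in> V"
      unfolding V_def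
    proof (intro mzv_space_add mzv_space_diff mzv_space_sum)
      fix j assume j: "j \<in> {..Suc N}"
      have "n p + n (Suc p) + (int j - 1) \<le> max (n p) (n (Suc p))" using j by (simp add: N)
      then show "faulhaber_coeff N j * mzeta r (merge_point r p (of_nat j - 1) s)
          \<in> mzv_space (positive_count (Suc r) n) (positive_weight (Suc r) n)"
        using term1[of p j N] pr by (simp add: V_def)
      have m: "n (Suc p) + n (Suc (Suc p)) + (int j - 1) \<le> max (n (Suc p)) (n (Suc (Suc p)))"
        using j by (simp add: N)
      have "(if j = 1 then 1 else 0) * mzeta r (merge_point r (Suc p) (of_nat j - 1) s) \<in> V"
        using merge[OF pr m] by (cases "j = 1") (auto simp: V_def mzv_space_0)
      then show "(faulhaber_coeff N j + (if j = 1 then 1 else 0)) * mzeta r (merge_point r (Suc p) (of_nat j - 1) s)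
          \<in> mzv_space (positive_count (Suc r) n) (positive_weight (Suc r) n)"
        unfolding distrib_right using term1[OF pr m, of N] unfolding V_def by (intro mzv_space_add)
    next
      \<comment> \<open>The correction \<open>0\<close> is the case \<open>j = 1\<close>, so
        \<open>merge\<close> applies with \<open>i = 0\<close>, where the first entry is
        deleted.\<close>
      show "(if p = 0 then mzeta r (merge_point r 0 0 s) else 0)
          \<in> mzv_space (positive_count (Suc r) n) (positive_weight (Suc r) n)"
        using merge[of 0 1] by (simp add: V_def mzv_space_0)
    qed
    finally show ?thesis by (simp add: s_def V_def)
  next
    case 3
    \<comment> \<open>Here all entries are positive, and the hyperplane on which the last coordinate
      is \<open>1\<close> is what rules out a divergent last entry.\<close>
    have "n (Suc r) \<noteq> 1" using regular_last_neq_1[OF s] s_nth[of "Suc r"] by auto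
    then have "admissible (Suc r) n" using 3 by (auto simp: admissible_def le_Suc_eq int_one_le_iff_zero_less)
    moreover have pos: "n l > 0" if "l \<in> {1..Suc r}" for l using 3 that by (cases "l = Suc r") auto
    then have "positive_count (Suc r) n = (\<Sum>l=1..Suc r. 1)"
      unfolding positive_count_def by (intro sum.cong) auto
    moreover have "int (positive_weight (Suc r) n) = (\<Sum>l=1..Suc r. n l)"
      unfolding positive_weight_def of_nat_sum using pos by (intro sum.cong) (auto simp: less_imp_le)
    ultimately have "mzv (Suc r) n \<in> mzv_space (positive_count (Suc r) n) (positive_weight (Suc r) n)"
      by (intro mzv_space_base) auto
    then show ?thesis by (simp add: mzv_def)
  qed
qed

theorem theorem2p16:
  fixes r :: nat and n :: "nat \<Rightarrow> int" and d w :: nat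
  assumes "r \<ge> 1"
    and "int_point r n \<in> regular_points r"
    and "d = card {i \<in> {1..r}. n i > 0}"
    and "int w = (\<Sum>i | i \<in> {1..r} \<and> n i > 0. n i)"
  shows "mzeta r (int_point r n) \<in> mzv_space d w"
proof -
  have "positive_count r n = d"
    unfolding positive_count_def assms(3) by (simp add: sum.If_cases Int_def)
  moreover have "int (positive_weight r n) = int w"
    unfolding positive_weight_def assms(4) of_nat_sum
    by (rule sum.mono_neutral_cong_right) auto
  ultimately show ?thesis using mzeta_int_point_in_mzv_space[OF assms(2)] by simp
qed

end
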